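(* Let $p,q\in(0,1)$ and let $\mathcal P_h^-$ be the time reversal of the heralding coin process with parameters $p,q$, with causal states $s_0^-,s_1^-,s_2^-$. Define $\mathcal Q^-=(\varepsilon_q^-,\Omega^-,\mathcal M^-)$ by $\Omega^-=\{|s_0^-\rangle,|s_1^-\rangle,|s_2^-\rangle\}$ with $$|s_0^-\rangle=|0\rangle,\qquad |s_1^-\rangle=\sqrt q\,|0\rangle+\sqrt{1-q}\,|1\rangle,\qquad |s_2^-\rangle=|1\rangle,$$ $\varepsilon_q^-(\overleftarrow y)=|s_i^-\rangle$ if and only if $\overleftarrow y\in s_i^-$, and $\mathcal M^-$ the measurement process described in the context. Then $\mathcal Q^-$ is an optimal quantum model for $\mathcal P_h^-$.
   Context: Heralding coin process and its reversal: take the stationary two-state Markov chain on $\{0,1\}$ flipping $0\to1$ with probability $p$ and $1\to0$ with probability $q$. The heralding coin process $\mathcal P_h^+$, $(X_t)_{t\in\mathbb Z}$, is obtained by replacing the first $0$ of each maximal run of $0$s by $2$. Its time reversal $\mathcal P_h^-$ is the law of $Y_t=X_{-(t+1)}$. Equivalently, $\mathcal P_h^-$ is the stationary process over $\{0,1,2\}$ with causal states $s_j^-=\{\overleftarrow y:y_{-1}=j\}$, $j=0,1,2$, in which emitting $j$ leads to $s_j^-$ and: from $s_0^-$ emit $0$ w.p. $1-p$, $2$ w.p. $p$; from $s_1^-$ emit $1$ w.p. $1-q$, $0$ w.p. $q(1-p)$, $2$ w.p. $qp$; from $s_2^-$ emit $1$ w.p. $1$. The causal states have probabilities $\pi_0^-=(q-pq)/(p+q)$,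 $\pi_1^-=p/(p+q)$, $\pi_2^-=pq/(p+q)$. Here pasts are $\overleftarrow Y=\dots Y_{-2}Y_{-1}$, futures $\overrightarrow Y=Y_0Y_1\dots$; causal states are the classes of pasts having the same conditional future distribution. Quantum model of a process: a tuple $\mathcal Q=(f,\Omega,\mathcal M)$, where $\Omega$ is a set of pure states of a physical system $\Xi$, $f$ maps each past $\overleftarrow y$ to $f(\overleftarrow y)=|s_{\overleftarrow y}\rangle\in\Omega$, and $\mathcal M$ is a quantum measurement process (quantum instrument) on $\Xi$ such that for every past $\overleftarrow y$, applying $\mathcal M$ to $\Xi$ in state $f(\overleftarrow y)$ (i) yields output $y$ with probability $P(Y_0=y|\overleftarrow Y=\overleftarrow y)$ and (ii) then leaves $\Xi$ in state $f(\overleftarrow yy)$. Its entropy is $C_q(\mathcal Q)=S(\rho)=-\mathrm{Tr}(\rho\log\rho)$ with $\rho=\sum_{\overleftarrow y}P(\overleftarrow Y=\overleftarrow y)|s_{\overleftarrow y}\rangle\langle s_{\overleftarrow y}|$. $\mathcal Q$ is optimal if $C_q(\mathcal Q')\ge C_q(\mathcal Q)$ for every other quantum model $\mathcal Q'$ of the same process. The process $\mathcal M^-$: given the memory qubit (first qubit) in state $|s_i^-\rangle$, adjoin a second and a third qubit in state $|0\rangle|0\rangle$. Write $C_U:|w\rangle|\psi\rangle\mapsto|w\rangle U^{(w\bmod2)}|\psi\rangle$ and $\bar C_U:|w\rangle|\psi\rangle\mapsto|w\rangle U^{(w+1\bmod2)}|\psi\rangle$. Apply $\bar C_{U_p}$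 with control qubit 1 and target qubit 2, where $U_p$ is a unitary with $U_p|0\rangle=\sqrt{1-p}|0\rangle+\sqrt p|1\rangle$; then $C_{U_q}$ with control qubit 1 and target qubit 3, where $U_q$ is a unitary with $U_q|0\rangle=\sqrt q|0\rangle+\sqrt{1-q}|1\rangle$; then $C_X$ (Pauli $X$) with control qubit 2 and target qubit 3. Measure the first two qubits in the computational basis, identifying outcomes $00\to y_t=0$, $10\to y_t=1$, $01\to y_t=2$, and retain the third qubit as the new memory. *)

theory Defs
  imports "HOL-Probability.Probability"
begin

section \<open>Stationary processes and causal states\<close>

text \<open>A process over the alphabet \<open>A\<close> is given by its law, a probability measure on
  bi-infinite sequences \<open>int \<Rightarrow> nat\<close> with the product sigma-algebra.\<close>

definition seq_space :: "nat set \<Rightarrow> (int \<Rightarrow> nat) measure" where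
  "seq_space A = PiM UNIV (\<lambda>_. count_space A)"

text \<open>A past is stored backwards: position \<open>k\<close> holds the symbol emitted at time \<open>-(k+1)\<close>.
  Hence the most recent symbol of \<open>h\<close> is \<open>h 0\<close>, and the past \<open>h\<close> followed by the
  symbol \<open>y\<close> is \<open>case_nat y h\<close>.\<close>

definition past :: "(int \<Rightarrow> nat) \<Rightarrow> nat \<Rightarrow> nat" where
  "past x = (\<lambda>k. x (- 1 - int k))"

definition recent :: "(int \<Rightarrow> nat) measure \<Rightarrow> (nat \<Rightarrow> nat) \<Rightarrow> nat \<Rightarrow> (int \<Rightarrow> nat) set" where
  "recent P h L = {x \<in> space P. \<forall>k<L. past x k = h k}"

definition pasts :: "(int \<Rightarrow> nat) measure \<Rightarrow> (nat \<Rightarrow> nat) set" where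
  "pasts P = {h. \<forall>L. measure P (recent P h L) > 0}"

text \<open>An individual past usually has probability zero. The probability that the future begins with
  the word \<open>w\<close> given the whole past \<open>h\<close> is the limit of the elementary conditional
  probabilities given the last \<open>L\<close> symbols; by martingale convergence it exists for almost every past
  and is a version of the conditional probability given the past.\<close>

definition cond_future :: "(int \<Rightarrow> nat) measure \<Rightarrow> (nat \<Rightarrow> nat) \<Rightarrow> nat list \<Rightarrow> real" where
  "cond_future P h w =
     lim (\<lambda>L. measure P {x \<in> recent P h L. \<forall>i<length w. x (int i) = w ! i}
              / measure P (recent P h L))"

definition causal_states :: "(int \<Rightarrow> nat) measure \<Rightarrow> (nat \<Rightarrow> nat) set set" where
  "causal_states P =
     pasts P // {(h, h'). h \<in> pasts P \<and> h' \<in> pasts P \<and>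
                          (\<forall>w. cond_future P h w = cond_future P h' w)}"


section \<open>The heralding coin process and its time reversal\<close>

definition coin_trans :: "real \<Rightarrow> real \<Rightarrow> nat \<Rightarrow> nat \<Rightarrow> real" where
  "coin_trans p q a b =
     (if a = 0 then (if b = 1 then p else 1 - p) else (if b = 0 then q else 1 - q))"

definition stationary_coin :: "real \<Rightarrow> real \<Rightarrow> (int \<Rightarrow> nat) measure \<Rightarrow> bool" where
  "stationary_coin p q C \<longleftrightarrow>
     prob_space C \<and> sets C = sets (seq_space {0, 1}) \<and>
     distr C C (\<lambda>x t. x (t + 1)) = C \<and>
     (\<forall>t n b. (\<forall>i. b i \<in> {0, 1}) \<longrightarrow>
        measure C {x \<in> space C. \<forall>i\<le>n. x (t + int i) = b i} =
        measure C {x \<in> space C. x t = b 0} * (\<Prod>i<n. coin_trans p q (b i) (b (Suc i))))"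

definition heralding :: "(int \<Rightarrow> nat) measure \<Rightarrow> (int \<Rightarrow> nat) measure" where
  "heralding C =
     distr C (seq_space {0, 1, 2}) (\<lambda>x t. if x t = 0 \<and> x (t - 1) \<noteq> 0 then 2 else x t)"

definition time_reversal :: "(int \<Rightarrow> nat) measure \<Rightarrow> (int \<Rightarrow> nat) measure" where
  "time_reversal P = distr P P (\<lambda>x t. x (- (t + 1)))"


section \<open>Quantum models\<close>

text \<open>Physical systems are separable Hilbert spaces with a distinguished orthonormal basis indexed by
  an arbitrary set \<open>B\<close> of natural numbers, that is, they are the spaces \<open>\<ell>\<^sup>2(B)\<close>, of
  any finite or countably infinite dimension. Vectors are coefficient functions vanishing outside
  \<open>B\<close>.\<close>

type_synonym ket = "nat \<Rightarrow> complex"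

definition ell2 :: "nat set \<Rightarrow> ket set" where
  "ell2 B = {\<psi>. (\<forall>i. i \<notin> B \<longrightarrow> \<psi> i = 0) \<and> (\<lambda>i. (cmod (\<psi> i))\<^sup>2) summable_on UNIV}"

definition norm_sq :: "ket \<Rightarrow> real" where
  "norm_sq \<psi> = (\<Sum>\<^sub>\<infinity>i. (cmod (\<psi> i))\<^sup>2)"

definition ket_inner :: "ket \<Rightarrow> ket \<Rightarrow> complex" where
  "ket_inner \<phi> \<psi> = (\<Sum>\<^sub>\<infinity>i. cnj (\<phi> i) * \<psi> i)"

text \<open>A quantum instrument with outcomes in \<open>A\<close>, in operator-sum form: the completely positive
  map of outcome \<open>y\<close> has the Kraus operators \<open>K y j\<close>, \<open>j = 0, 1, 2, \<dots>\<close> (almost all of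
  which may be zero), and the last condition says that the sum of these maps over all outcomes is
  trace preserving. It also forces every \<open>K y j\<close> to be bounded.\<close>

definition instrument :: "nat set \<Rightarrow> nat set \<Rightarrow> (nat \<Rightarrow> nat \<Rightarrow> ket \<Rightarrow> ket) \<Rightarrow> bool" where
  "instrument A B K \<longleftrightarrow>
     (\<forall>y\<in>A. \<forall>j. \<forall>\<phi>\<in>ell2 B. K y j \<phi> \<in> ell2 B) \<and>
     (\<forall>y\<in>A. \<forall>j. \<forall>\<phi>\<in>ell2 B. \<forall>\<psi>\<in>ell2 B. \<forall>c.
        K y j (\<lambda>i. \<phi> i + c * \<psi> i) = (\<lambda>i. K y j \<phi> i + c * K y j \<psi> i)) \<and>
     (\<forall>\<psi>\<in>ell2 B. ((\<lambda>(y, j). norm_sq (K y j \<psi>)) has_sum norm_sq \<psi>) (A \<times> UNIV))"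

record qmodel =
  qbasis :: "nat set"
  enc :: "(nat \<Rightarrow> nat) \<Rightarrow> ket"
  qstates :: "ket set"
  kraus :: "nat \<Rightarrow> nat \<Rightarrow> ket \<Rightarrow> ket"

text \<open>The density matrix of the memory is an integral over the pasts. Its integrand must be
  measurable, which is the only regularity demanded of an encoding; it does not depend on the phases
  of the vectors. The last condition states that the unnormalised state after outcome \<open>y\<close>
  is the pure state encoding the extended past, with weight the probability of \<open>y\<close>.\<close>

definition quantum_model :: "nat set \<Rightarrow> (int \<Rightarrow> nat) measure \<Rightarrow> qmodel \<Rightarrow> bool" where
  "quantum_model A P Q \<longleftrightarrow>
     qstates Q \<subseteq> {\<psi> \<in> ell2 (qbasis Q). norm_sq \<psi> = 1} \<and>
     (\<forall>h\<in>pasts P. enc Q h \<in> qstates Q) \<and>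
     (\<forall>a b. set_borel_measurable P {x \<in> space P. past x \<in> pasts P}
              (\<lambda>x. enc Q (past x) a * cnj (enc Q (past x) b))) \<and>
     instrument A (qbasis Q) (kraus Q) \<and>
     (\<forall>h\<in>pasts P. \<forall>y\<in>A.
        ((\<lambda>j. norm_sq (kraus Q y j (enc Q h))) has_sum cond_future P h [y]) UNIV) \<and>
     (\<forall>h\<in>pasts P. \<forall>y\<in>A. cond_future P h [y] > 0 \<longrightarrow>
        (\<forall>a b. ((\<lambda>j. kraus Q y j (enc Q h) a * cnj (kraus Q y j (enc Q h) b)) has_sum
                  complex_of_real (cond_future P h [y]) *
                  (enc Q (case_nat y h) a * cnj (enc Q (case_nat y h) b))) UNIV))"

definition memory_state :: "(int \<Rightarrow> nat) measure \<Rightarrow> qmodel \<Rightarrow> nat \<Rightarrow> nat \<Rightarrow> complex" where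
  "memory_state P Q a b =
     set_lebesgue_integral P {x \<in> space P. past x \<in> pasts P}
       (\<lambda>x. enc Q (past x) a * cnj (enc Q (past x) b))"

text \<open>\<open>\<rho> = (\<Sum>k\<in>N. \<mu>\<^sub>k |e\<^sub>k\<rangle>\<langle>e\<^sub>k|)\<close> with orthonormal \<open>e\<^sub>k\<close> and \<open>\<mu>\<^sub>k > 0\<close>: the numbers
  \<open>\<mu>\<^sub>k\<close> are the non-zero eigenvalues of \<open>\<rho>\<close>, listed with multiplicity.\<close>

definition spectral_decomposition ::
    "(nat \<Rightarrow> nat \<Rightarrow> complex) \<Rightarrow> nat set \<Rightarrow> (nat \<Rightarrow> real) \<Rightarrow> (nat \<Rightarrow> ket) \<Rightarrow> bool" where
  "spectral_decomposition \<rho> N \<mu> e \<longleftrightarrow>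
     (\<forall>k\<in>N. \<mu> k > 0 \<and> e k \<in> ell2 UNIV) \<and>
     (\<forall>k\<in>N. \<forall>l\<in>N. ket_inner (e k) (e l) = (if k = l then 1 else 0)) \<and>
     (\<forall>a b. ((\<lambda>k. complex_of_real (\<mu> k) * (e k a * cnj (e k b))) has_sum \<rho> a b) N)"

text \<open>\<open>S(\<rho>) = - Tr (\<rho> log \<rho>)\<close>, in bits and possibly infinite. A density matrix has a spectral
  decomposition by the spectral theorem, and any two have the same eigenvalues with the same
  multiplicities, so the infimum is over a one-element set.\<close>

definition vn_entropy :: "(nat \<Rightarrow> nat \<Rightarrow> complex) \<Rightarrow> ennreal" where
  "vn_entropy \<rho> =
     Inf {s. \<exists>N \<mu> e. spectral_decomposition \<rho> N \<mu> e \<and>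
                     s = (\<Sum>\<^sub>\<infinity>k\<in>N. ennreal (- (\<mu> k * log 2 (\<mu> k))))}"

definition model_entropy :: "(int \<Rightarrow> nat) measure \<Rightarrow> qmodel \<Rightarrow> ennreal" where
  "model_entropy P Q = vn_entropy (memory_state P Q)"

definition optimal_quantum_model :: "nat set \<Rightarrow> (int \<Rightarrow> nat) measure \<Rightarrow> qmodel \<Rightarrow> bool" where
  "optimal_quantum_model A P Q \<longleftrightarrow>
     quantum_model A P Q \<and>
     (\<forall>Q'. quantum_model A P Q' \<longrightarrow> model_entropy P Q \<le> model_entropy P Q')"


section \<open>The quantum model of the reversed process\<close>

definition basis_ket :: "nat \<Rightarrow> ket" where
  "basis_ket i = (\<lambda>k. if k = i then 1 else 0)"

definition reverse_ket :: "real \<Rightarrow> nat \<Rightarrow> ket" where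
  "reverse_ket q i =
     (if i = 0 then basis_ket 0
      else if i = 1 then
        (\<lambda>k. complex_of_real (sqrt q) * basis_ket 0 k + complex_of_real (sqrt (1 - q)) * basis_ket 1 k)
      else basis_ket 1)"

text \<open>Single-qubit gates are matrices with row and column indices 0 and 1.\<close>

definition qubit_unitary :: "(nat \<Rightarrow> nat \<Rightarrow> complex) \<Rightarrow> bool" where
  "qubit_unitary U \<longleftrightarrow>
     (\<forall>i<2. \<forall>j<2. (\<Sum>k<2. cnj (U k i) * U k j) = (if i = j then 1 else 0))"

definition gate :: "(nat \<Rightarrow> nat \<Rightarrow> complex) \<Rightarrow> ket \<Rightarrow> ket" where
  "gate U \<psi> = (\<lambda>r. if r < 2 then (\<Sum>k<2. U r k * \<psi> k) else 0)"

definition pauli_X :: "nat \<Rightarrow> nat \<Rightarrow> complex" where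
  "pauli_X r k = (if r = k then 0 else 1)"

text \<open>Three-qubit vectors have amplitudes \<open>\<Psi> a b c\<close> on \<open>|a\<rangle>|b\<rangle>|c\<rangle>\<close>. In the next three
  definitions the name gives the control and then the target qubit.\<close>

definition cbar_12 ::
    "(nat \<Rightarrow> nat \<Rightarrow> complex) \<Rightarrow> (nat \<Rightarrow> nat \<Rightarrow> ket) \<Rightarrow> (nat \<Rightarrow> nat \<Rightarrow> ket)" where
  "cbar_12 U \<Psi> = (\<lambda>a b c. (gate U ^^ ((a + 1) mod 2)) (\<lambda>b'. \<Psi> a b' c) b)"

definition c_13 ::
    "(nat \<Rightarrow> nat \<Rightarrow> complex) \<Rightarrow> (nat \<Rightarrow> nat \<Rightarrow> ket) \<Rightarrow> (nat \<Rightarrow> nat \<Rightarrow> ket)" where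
  "c_13 U \<Psi> = (\<lambda>a b c. (gate U ^^ (a mod 2)) (\<lambda>c'. \<Psi> a b c') c)"

definition c_23 ::
    "(nat \<Rightarrow> nat \<Rightarrow> complex) \<Rightarrow> (nat \<Rightarrow> nat \<Rightarrow> ket) \<Rightarrow> (nat \<Rightarrow> nat \<Rightarrow> ket)" where
  "c_23 U \<Psi> = (\<lambda>a b c. (gate U ^^ (b mod 2)) (\<lambda>c'. \<Psi> a b c') c)"

definition reverse_circuit ::
    "(nat \<Rightarrow> nat \<Rightarrow> complex) \<Rightarrow> (nat \<Rightarrow> nat \<Rightarrow> complex) \<Rightarrow> ket \<Rightarrow> (nat \<Rightarrow> nat \<Rightarrow> ket)" where
  "reverse_circuit Up Uq \<psi> =
     c_23 pauli_X (c_13 Uq (cbar_12 Up (\<lambda>a b c. \<psi> a * basis_ket 0 b * basis_ket 0 c)))"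

text \<open>Outcome of the first two qubits identified with the output symbol. The remaining outcome
  \<open>(1, 1)\<close> has amplitude zero.\<close>

definition outcome_bits :: "nat \<Rightarrow> nat \<times> nat" where
  "outcome_bits y = (if y = 0 then (0, 0) else if y = 1 then (1, 0) else (0, 1))"

text \<open>Projecting the first two qubits on the outcome leaves one Kraus operator per output symbol.\<close>

definition reverse_kraus ::
    "(nat \<Rightarrow> nat \<Rightarrow> complex) \<Rightarrow> (nat \<Rightarrow> nat \<Rightarrow> complex) \<Rightarrow> nat \<Rightarrow> nat \<Rightarrow> ket \<Rightarrow> ket" where
  "reverse_kraus Up Uq y j \<psi> =
     (if j = 0
      then reverse_circuit Up Uq \<psi> (fst (outcome_bits y)) (snd (outcome_bits y))
      else (\<lambda>_. 0))"

end

(* An instrument cannot decrease the distinguishability of states, so the overlap of two memory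
   states is at most the Bhattacharyya coefficient of the distributions of the next symbol: sqrt q
   between the causal states 0 and 1, sqrt (1 - q) between 1 and 2, and 0 between 0 and 2. The
   proposed model attains these bounds, and its Gram matrix has non-negative entries; by a Perron
   argument its largest eigenvalue therefore dominates every eigenvalue of every other memory
   state. Since the proposed memory has rank two, its spectrum (c, 1 - c) majorises the spectrum
   of any other model, so its entropy is smallest. *)

theory Submission
  imports Defs
begin

section \<open>Vectors and instruments\<close>

text \<open>A competing model may encode two pasts of the same causal state by different kets, so it
  can have uncountably many memory states, and there is no three-by-three Gram matrix to compare
  with. The Perron argument therefore runs on an eigenvector \<open>v\<close> of the competitor's
  memory state: its overlaps with memory states are replaced by their suprema over each causal
  state, and the three resulting inequalities are added with positive weights that form a left
  eigenvector of the matrix with entries \<open>herald_prob p q j * overlap_bound q i j\<close>. The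
  competitor's system may also be infinite-dimensional. Traces and matrix-vector products are then
  infinite series, and exchanging them with the integral over the pasts rests on dominated
  convergence. As the entropy is an infimum over spectral decompositions, the lower bound is proved
  for each decomposition, and the matching upper bound comes from exhibiting one.\<close>

lemma has_sum_diff:
  fixes f g :: "'a \<Rightarrow> 'b :: real_normed_vector"
  assumes "(f has_sum a) A" "(g has_sum b) A"
  shows "((\<lambda>x. f x - g x) has_sum (a - b)) A"
proof -
  have "((\<lambda>x. - g x) has_sum - b) A"
    using assms(2) by (simp add: has_sum_uminus)
  from has_sum_add[OF assms(1) this] show ?thesis by simp
qed

section \<open>Cauchy-Schwarz inequalities and inner products in \<open>ell2\<close>\<close>

lemma Cauchy_Schwarz_finite:
  fixes f g :: "'a \<Rightarrow> real"
  assumes f: "((\<lambda>i. (f i)\<^sup>2) has_sum a) A" and g: "((\<lambda>i. (g i)\<^sup>2) has_sum b) A"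
    and F: "finite F" "F \<subseteq> A"
  shows "(\<Sum>i\<in>F. \<bar>f i\<bar> * \<bar>g i\<bar>) \<le> sqrt a * sqrt b"
proof -
  have "(\<Sum>i\<in>F. (f i)\<^sup>2) \<le> a"
    by (rule has_sum_mono2[OF has_sum_finite[OF F(1)] f F(2)]) auto
  moreover have "(\<Sum>i\<in>F. (g i)\<^sup>2) \<le> b"
    by (rule has_sum_mono2[OF has_sum_finite[OF F(1)] g F(2)]) auto
  ultimately have "L2_set f F * L2_set g F \<le> sqrt a * sqrt b"
    unfolding L2_set_def
    by (intro mult_mono real_sqrt_le_mono real_sqrt_ge_zero has_sum_nonneg[OF f] sum_nonneg) auto
  with L2_set_mult_ineq[of f g F] show ?thesis by linarith
qed

lemma Cauchy_Schwarz_has_sum: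
  fixes f g :: "'a \<Rightarrow> real"
  assumes f: "((\<lambda>i. (f i)\<^sup>2) has_sum a) A" and g: "((\<lambda>i. (g i)\<^sup>2) has_sum b) A"
  shows "(\<lambda>i. \<bar>f i\<bar> * \<bar>g i\<bar>) summable_on A"
    and "(\<Sum>\<^sub>\<infinity>i\<in>A. \<bar>f i\<bar> * \<bar>g i\<bar>) \<le> sqrt a * sqrt b"
proof -
  show *: "(\<lambda>i. \<bar>f i\<bar> * \<bar>g i\<bar>) summable_on A"
  proof (rule nonneg_bdd_above_summable_on)
    show "bdd_above (sum (\<lambda>i. \<bar>f i\<bar> * \<bar>g i\<bar>) ` {F. F \<subseteq> A \<and> finite F})"
      by (rule bdd_aboveI2[where M = "sqrt a * sqrt b"]) (simp add: Cauchy_Schwarz_finite[OF f g])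
  qed simp
  show "(\<Sum>\<^sub>\<infinity>i\<in>A. \<bar>f i\<bar> * \<bar>g i\<bar>) \<le> sqrt a * sqrt b"
    by (rule infsum_le_finite_sums[OF *]) (auto intro: Cauchy_Schwarz_finite[OF f g])
qed

lemma ell2_mono: "\<phi> \<in> ell2 B \<Longrightarrow> \<phi> \<in> ell2 UNIV"
  by (simp add: ell2_def)

lemma norm_sq_has_sum: "\<phi> \<in> ell2 B \<Longrightarrow> ((\<lambda>i. (cmod (\<phi> i))\<^sup>2) has_sum norm_sq \<phi>) UNIV"
  by (simp add: ell2_def norm_sq_def)

lemma norm_sq_nonneg: "0 \<le> norm_sq \<phi>"
  unfolding norm_sq_def by (rule infsum_nonneg) simp

lemma cmod_sq_le_norm_sq:
  assumes "\<phi> \<in> ell2 B"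
  shows "(cmod (\<phi> a))\<^sup>2 \<le> norm_sq \<phi>"
proof -
  have "(\<Sum>i\<in>{a}. (cmod (\<phi> i))\<^sup>2) \<le> norm_sq \<phi>"
    by (rule has_sum_mono2[OF has_sum_finite norm_sq_has_sum[OF assms]]) auto
  then show ?thesis by simp
qed

lemma cmod_le_1:
  assumes "\<phi> \<in> ell2 B" "norm_sq \<phi> = 1"
  shows "cmod (\<phi> a) \<le> 1"
proof (rule power2_le_imp_le)
  show "(cmod (\<phi> a))\<^sup>2 \<le> 1\<^sup>2"
    using cmod_sq_le_norm_sq[OF assms(1), of a] assms(2) by simp
qed simp

lemma ket_inner_has_sum:
  assumes "\<phi> \<in> ell2 B" "\<psi> \<in> ell2 B'"
  shows "((\<lambda>i. cnj (\<phi> i) * \<psi> i) has_sum ket_inner \<phi> \<psi>) UNIV"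
proof -
  have "(\<lambda>i. \<bar>cmod (\<phi> i)\<bar> * \<bar>cmod (\<psi> i)\<bar>) summable_on UNIV"
    by (rule Cauchy_Schwarz_has_sum(1)[OF norm_sq_has_sum[OF assms(1)] norm_sq_has_sum[OF assms(2)]])
  then have "(\<lambda>i. norm (cnj (\<phi> i) * \<psi> i)) summable_on UNIV"
    by (simp add: norm_mult)
  then show ?thesis
    unfolding ket_inner_def by (rule has_sum_infsum[OF abs_summable_summable])
qed

lemma partial_inner_bound:
  assumes "\<phi> \<in> ell2 B" "\<psi> \<in> ell2 B'" "finite F"
  shows "cmod (\<Sum>i\<in>F. cnj (\<phi> i) * \<psi> i) \<le> sqrt (norm_sq \<phi>) * sqrt (norm_sq \<psi>)"
proof -
  have "cmod (\<Sum>i\<in>F. cnj (\<phi> i) * \<psi> i) \<le> (\<Sum>i\<in>F. \<bar>cmod (\<phi> i)\<bar> * \<bar>cmod (\<psi> i)\<bar>)"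
    by (rule order_trans[OF norm_sum]) (simp add: norm_mult)
  also have "\<dots> \<le> sqrt (norm_sq \<phi>) * sqrt (norm_sq \<psi>)"
    by (rule Cauchy_Schwarz_finite[OF norm_sq_has_sum[OF assms(1)] norm_sq_has_sum[OF assms(2)] assms(3)])
       simp
  finally show ?thesis .
qed

lemma partial_inner_tendsto:
  assumes "\<phi> \<in> ell2 B" "\<psi> \<in> ell2 B'"
  shows "(\<lambda>n. \<Sum>i<n. cnj (\<phi> i) * \<psi> i) \<longlonglongrightarrow> ket_inner \<phi> \<psi>"
  using has_sum_imp_sums[OF ket_inner_has_sum[OF assms]] by (simp add: sums_def)

lemma ket_inner_bound:
  assumes "\<phi> \<in> ell2 B" "\<psi> \<in> ell2 B'"
  shows "cmod (ket_inner \<phi> \<psi>) \<le> sqrt (norm_sq \<phi>) * sqrt (norm_sq \<psi>)"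
  by (rule LIMSEQ_le_const2[OF tendsto_norm[OF partial_inner_tendsto[OF assms]]])
     (intro exI allI impI partial_inner_bound[OF assms] finite_lessThan)

lemma ket_inner_self:
  assumes "\<phi> \<in> ell2 B"
  shows "ket_inner \<phi> \<phi> = complex_of_real (norm_sq \<phi>)"
proof -
  have eq: "complex_of_real ((cmod (\<phi> i))\<^sup>2) = cnj (\<phi> i) * \<phi> i" for i
    by (subst mult.commute) (rule complex_norm_square)
  have "((\<lambda>i. complex_of_real ((cmod (\<phi> i))\<^sup>2)) has_sum complex_of_real (norm_sq \<phi>)) UNIV"
    by (intro has_sum_of_real norm_sq_has_sum[OF assms])
  from ket_inner_has_sum[OF assms assms] this[unfolded eq] show ?thesis
    by (rule has_sum_unique)
qed

lemma ell2_add: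
  assumes "\<phi> \<in> ell2 B" "\<psi> \<in> ell2 B"
  shows "(\<lambda>i. \<phi> i + c * \<psi> i) \<in> ell2 B"
proof -
  have "(\<lambda>i. 2 * (cmod (\<phi> i))\<^sup>2 + 2 * (cmod c)\<^sup>2 * (cmod (\<psi> i))\<^sup>2) summable_on UNIV"
    using assms by (intro summable_on_add summable_on_cmult_right) (auto simp: ell2_def)
  then have "(\<lambda>i. (cmod (\<phi> i + c * \<psi> i))\<^sup>2) summable_on UNIV"
  proof (rule summable_on_comparison_test)
    fix i
    have "(cmod (\<phi> i + c * \<psi> i))\<^sup>2 \<le> (cmod (\<phi> i) + cmod c * cmod (\<psi> i))\<^sup>2"
      using norm_triangle_ineq[of "\<phi> i" "c * \<psi> i"] by (intro power_mono) (simp_all add: norm_mult)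
    also have "\<dots> \<le> 2 * (cmod (\<phi> i))\<^sup>2 + 2 * (cmod c)\<^sup>2 * (cmod (\<psi> i))\<^sup>2"
      using sum_squares_bound[of "cmod (\<phi> i)" "cmod c * cmod (\<psi> i)"]
      by (simp add: power2_sum power_mult_distrib)
    finally show "(cmod (\<phi> i + c * \<psi> i))\<^sup>2 \<le> 2 * (cmod (\<phi> i))\<^sup>2 + 2 * (cmod c)\<^sup>2 * (cmod (\<psi> i))\<^sup>2" .
  qed simp
  with assms show ?thesis by (auto simp: ell2_def)
qed

text \<open>Two terms suffice because a free factor \<open>c\<close> is kept: choosing its phase
  later turns the real part into the modulus of the inner product.\<close>

lemma norm_sq_polarization:
  assumes "\<phi> \<in> ell2 B" "\<psi> \<in> ell2 B"
  shows "norm_sq (\<lambda>i. \<phi> i + c * \<psi> i) - norm_sq (\<lambda>i. \<phi> i + (- c) * \<psi> i)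
         = 4 * Re (c * ket_inner \<phi> \<psi>)"
proof -
  have eq: "(cmod (\<phi> i + c * \<psi> i))\<^sup>2 - (cmod (\<phi> i + (- c) * \<psi> i))\<^sup>2
      = 4 * Re (c * (cnj (\<phi> i) * \<psi> i))" for i
    unfolding cmod_power2 by (simp add: power2_eq_square) algebra
  have "((\<lambda>i. (cmod (\<phi> i + c * \<psi> i))\<^sup>2 - (cmod (\<phi> i + (- c) * \<psi> i))\<^sup>2) has_sum
          norm_sq (\<lambda>i. \<phi> i + c * \<psi> i) - norm_sq (\<lambda>i. \<phi> i + (- c) * \<psi> i)) UNIV"
    by (intro has_sum_diff norm_sq_has_sum[OF ell2_add[OF assms]])
  moreover have "((\<lambda>i. 4 * Re (c * (cnj (\<phi> i) * \<psi> i))) has_sum 4 * Re (c * ket_inner \<phi> \<psi>)) UNIV"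
    by (intro has_sum_cmult_right has_sum_Re ket_inner_has_sum[OF assms])
  ultimately show ?thesis
    unfolding eq by (rule has_sum_unique)
qed

text \<open>Trace preservation only speaks about norms, so the inner product is recovered from them by
  polarization, with the phase chosen such that \<open>c * ket_inner u v\<close> is non-negative.\<close>

lemma instrument_overlap:
  assumes inst: "instrument A B K" and A: "finite A"
    and u: "u \<in> ell2 B" and v: "v \<in> ell2 B"
    and a: "\<And>y. y \<in> A \<Longrightarrow> ((\<lambda>j. norm_sq (K y j u)) has_sum a y) UNIV"
    and b: "\<And>y. y \<in> A \<Longrightarrow> ((\<lambda>j. norm_sq (K y j v)) has_sum b y) UNIV"
  shows "cmod (ket_inner u v) \<le> (\<Sum>y\<in>A. sqrt (a y * b y))"
proof -
  define z where "z = ket_inner u v"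
  define c where "c = (if z = 0 then 1 else cnj z / cmod z)"
  have c: "cmod c = 1" "c * z = cmod z"
  proof -
    show "cmod c = 1" by (simp add: c_def norm_divide)
    have "z * cnj z = complex_of_real (cmod z) * complex_of_real (cmod z)"
      using complex_norm_square[of z] by (simp add: power2_eq_square)
    then show "c * z = cmod z" by (simp add: c_def field_simps)
  qed
  \<comment> \<open>Cauchy-Schwarz enters twice: in the Hilbert space it bounds the overlap of the
    images of \<open>u\<close> and \<open>v\<close> under \<open>K y j\<close> by
    \<open>g y j\<close>, and over \<open>j\<close> it bounds the sum of the \<open>g y j\<close> by
    one Bhattacharyya term.\<close>
  define g where "g y j = sqrt (norm_sq (K y j u)) * sqrt (norm_sq (K y j v))" for y j
  have g_nonneg: "0 \<le> g y j" for y j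
    by (simp add: g_def norm_sq_nonneg)
  have K: "K y j \<phi> \<in> ell2 B" if "y \<in> A" "\<phi> \<in> ell2 B" for y j \<phi>
    using inst that by (auto simp: instrument_def)
  have lin: "K y j (\<lambda>i. u i + d * v i) = (\<lambda>i. K y j u i + d * K y j v i)" if "y \<in> A" for y j d
    using inst that u v by (auto simp: instrument_def)
  have tp: "((\<lambda>(y, j). norm_sq (K y j \<psi>)) has_sum norm_sq \<psi>) (A \<times> UNIV)" if "\<psi> \<in> ell2 B" for \<psi>
    using inst that by (auto simp: instrument_def)
  have g: "g y summable_on UNIV" "infsum (g y) UNIV \<le> sqrt (a y * b y)" if y: "y \<in> A" for y
  proof -
    have "((\<lambda>j. (sqrt (norm_sq (K y j u)))\<^sup>2) has_sum a y) UNIV"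
      "((\<lambda>j. (sqrt (norm_sq (K y j v)))\<^sup>2) has_sum b y) UNIV"
      using a[OF y] b[OF y] by (simp_all add: norm_sq_nonneg)
    note CS = Cauchy_Schwarz_has_sum[OF this]
    have "g y = (\<lambda>j. \<bar>sqrt (norm_sq (K y j u))\<bar> * \<bar>sqrt (norm_sq (K y j v))\<bar>)"
      by (simp add: g_def fun_eq_iff norm_sq_nonneg)
    with CS show "g y summable_on UNIV" "infsum (g y) UNIV \<le> sqrt (a y * b y)"
      by (simp_all only: real_sqrt_mult)
  qed
  have "((\<lambda>(y, j). norm_sq (K y j (\<lambda>i. u i + c * v i)) - norm_sq (K y j (\<lambda>i. u i + (- c) * v i)))
          has_sum 4 * Re (c * z)) (A \<times> UNIV)"
    using has_sum_diff[OF tp[OF ell2_add[OF u v, of c]] tp[OF ell2_add[OF u v, of "- c"]]]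
    unfolding norm_sq_polarization[OF u v, of c] z_def case_prod_unfold .
  moreover have "((\<lambda>(y, j). 4 * g y j) has_sum (\<Sum>y\<in>A. 4 * infsum (g y) UNIV)) (A \<times> UNIV)"
  proof -
    have row: "((\<lambda>j. case (y, j) of (y, j) \<Rightarrow> 4 * g y j) has_sum 4 * infsum (g y) UNIV) UNIV"
      if "y \<in> A" for y
      unfolding prod.case using g(1)[OF that] by (intro has_sum_cmult_right has_sum_infsum)
    have col: "((\<lambda>y. 4 * infsum (g y) UNIV) has_sum (\<Sum>y\<in>A. 4 * infsum (g y) UNIV)) A"
      by (rule has_sum_finite[OF A])
    show ?thesis
      by (rule has_sum_SigmaI[OF row col summable_on_SigmaI[OF row has_sum_imp_summable[OF col]]])
         (auto simp: g_nonneg)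
  qed
  \<comment> \<open>The two double series are compared term by term: linearity moves the
    combinations of \<open>u\<close> and \<open>v\<close> through \<open>K y j\<close>, and
    polarization applies once more to the images.\<close>
  ultimately have "4 * Re (c * z) \<le> (\<Sum>y\<in>A. 4 * infsum (g y) UNIV)"
  proof (rule has_sum_mono; clarify)
    fix y j assume y: "y \<in> A"
    have "4 * Re (c * ket_inner (K y j u) (K y j v)) \<le> 4 * cmod (c * ket_inner (K y j u) (K y j v))"
      by (intro mult_left_mono complex_Re_le_cmod) simp
    also have "\<dots> \<le> 4 * g y j"
      using ket_inner_bound[OF K[OF y u] K[OF y v], of j j] by (simp add: norm_mult c(1) g_def)
    finally show "norm_sq (K y j (\<lambda>i. u i + c * v i)) - norm_sq (K y j (\<lambda>i. u i + (- c) * v i))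
        \<le> 4 * g y j"
      unfolding lin[OF y] norm_sq_polarization[OF K[OF y u] K[OF y v]] .
  qed
  also have "\<dots> \<le> (\<Sum>y\<in>A. 4 * sqrt (a y * b y))"
    using g(2) by (intro sum_mono) auto
  finally show ?thesis
    unfolding sum_distrib_left[symmetric] c(2) Re_complex_of_real by (simp add: z_def)
qed

section \<open>Minimal entropy under a bound on the largest probability\<close>

lemma convex_on_x_ln_x: "convex_on {0<..} (\<lambda>x::real. x * ln x)"
  by (rule f''_ge0_imp_convex[where f' = "\<lambda>x. ln x + 1" and f'' = "\<lambda>x. 1 / x"])
     (auto intro!: derivative_eq_intros)

definition binary_entropy :: "real \<Rightarrow> real" where
  "binary_entropy x = - (x * log 2 x) - (1 - x) * log 2 (1 - x)"

text \<open>\<open>x\<close> and \<open>1 - x\<close> are convex combinations of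
  \<open>1 - c\<close> and \<open>c\<close> with the weights \<open>t\<close> and
  \<open>1 - t\<close> interchanged, so adding the two convexity inequalities for x ln x makes the
  weights disappear. At \<open>c = 1 / 2\<close> the interval is a point, and the formula for
  \<open>t\<close> would divide by zero.\<close>

lemma binary_entropy_mono:
  assumes "1 / 2 \<le> c" "c < 1" "1 - c \<le> x" "x \<le> c"
  shows "binary_entropy c \<le> binary_entropy x"
proof -
  define f where "f = (\<lambda>x::real. x * ln x)"
  have "f x + f (1 - x) \<le> f c + f (1 - c)"
  proof (cases "c = 1 / 2")
    case True
    with assms have "x = c" by simp
    then show ?thesis by simp
  next
    case False
    define t where "t = (x - (1 - c)) / (2 * c - 1)"
    have c: "2 * c - 1 > 0" using assms False by simp
    then have t: "0 \<le> t" "t \<le> 1" using assms by (auto simp: t_def)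
    have "t * (2 * c - 1) = x - (1 - c)"
      using c by (simp add: t_def)
    then have x: "x = (1 - t) * (1 - c) + t * c"
      by (simp add: algebra_simps)
    have x': "1 - x = (1 - t) * c + t * (1 - c)"
      by (simp add: x algebra_simps)
    have conv: "f ((1 - t) * a + t * b) \<le> (1 - t) * f a + t * f b" if "a > 0" "b > 0" for a b
      using convex_onD[OF convex_on_x_ln_x, of t a b] t that by (simp add: f_def)
    have "f x \<le> (1 - t) * f (1 - c) + t * f c"
      unfolding x by (rule conv) (use assms in auto)
    moreover have "f (1 - x) \<le> (1 - t) * f c + t * f (1 - c)"
      unfolding x' by (rule conv) (use assms in auto)
    ultimately show ?thesis by (simp add: algebra_simps)
  qed
  then have "(f x + f (1 - x)) / ln 2 \<le> (f c + f (1 - c)) / ln 2"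
    by (intro divide_right_mono) auto
  then show ?thesis
    by (simp add: binary_entropy_def log_def f_def add_divide_distrib)
qed

text \<open>Lets an ordinary convergent series bound a possibly infinite entropy from below:
  convergence is asked of the smaller series only, the larger one being summed in
  \<open>ennreal\<close>.\<close>

lemma infsum_ennreal_ge:
  assumes "(f has_sum S) N" "\<And>k. k \<in> N \<Longrightarrow> 0 \<le> f k" "\<And>k. k \<in> N \<Longrightarrow> f k \<le> g k"
  shows "ennreal S \<le> (\<Sum>\<^sub>\<infinity>k\<in>N. ennreal (g k))"
proof -
  have "((\<lambda>k. ennreal (f k)) has_sum ennreal S) N"
    unfolding has_sum_def
  proof (rule Lim_transform_eventually)
    show "((\<lambda>F. ennreal (sum f F)) \<longlongrightarrow> ennreal S) (finite_subsets_at_top N)"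
      using assms(1) by (intro tendsto_ennrealI) (simp add: has_sum_def)
    show "\<forall>\<^sub>F F in finite_subsets_at_top N. ennreal (sum f F) = (\<Sum>k\<in>F. ennreal (f k))"
      by (intro eventually_finite_subsets_at_top_weakI sum_ennreal[symmetric]) (use assms(2) in auto)
  qed
  then show ?thesis
    by (rule has_sum_mono[OF _ has_sum_infsum[OF nonneg_summable_on_complete]])
       (auto intro!: ennreal_leI assms(3))
qed

text \<open>Majorisation is replaced by bounds linear in the probabilities. If no
  \<open>\<mu> k\<close> exceeds \<open>1 - c\<close>, every \<open>- log 2 (\<mu> k)\<close> is at
  least \<open>- log 2 (1 - c)\<close>, which dominates the binary entropy because
  \<open>1 - c \<le> c\<close>. Otherwise some \<open>\<mu> m\<close> lies between
  \<open>1 - c\<close> and \<open>c\<close>; merging all other weights into one only lowers the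
  entropy, and \<open>binary_entropy_mono\<close> finishes.\<close>

lemma entropy_ge_binary_entropy:
  fixes \<mu> :: "'a \<Rightarrow> real"
  assumes sum: "(\<mu> has_sum 1) N" and pos: "\<And>k. k \<in> N \<Longrightarrow> 0 < \<mu> k"
    and le: "\<And>k. k \<in> N \<Longrightarrow> \<mu> k \<le> c" and c: "1 / 2 \<le> c" "c < 1"
  shows "ennreal (binary_entropy c) \<le> (\<Sum>\<^sub>\<infinity>k\<in>N. ennreal (- (\<mu> k * log 2 (\<mu> k))))"
proof (cases "\<forall>k\<in>N. \<mu> k \<le> 1 - c")
  case True
  have "ennreal (- log 2 (1 - c) * 1) \<le> (\<Sum>\<^sub>\<infinity>k\<in>N. ennreal (- (\<mu> k * log 2 (\<mu> k))))"
  proof (rule infsum_ennreal_ge)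
    show "((\<lambda>k. - log 2 (1 - c) * \<mu> k) has_sum - log 2 (1 - c) * 1) N"
      by (intro has_sum_cmult_right sum)
    fix k assume k: "k \<in> N"
    have "log 2 (1 - c) \<le> 0" using c by simp
    then show "0 \<le> - log 2 (1 - c) * \<mu> k"
      using pos[OF k] by (simp add: mult_nonpos_nonneg)
    have "log 2 (\<mu> k) \<le> log 2 (1 - c)"
      using True k pos[OF k] by auto
    then show "- log 2 (1 - c) * \<mu> k \<le> - (\<mu> k * log 2 (\<mu> k))"
      using pos[OF k] by (simp add: mult.commute)
  qed
  moreover have "binary_entropy c \<le> - log 2 (1 - c)"
  proof -
    have "c * log 2 (1 - c) \<le> c * log 2 c"
      using c by (intro mult_left_mono) auto
    then show ?thesis by (simp add: binary_entropy_def algebra_simps)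
  qed
  ultimately show ?thesis
    by (metis ennreal_leI mult.right_neutral order_trans)
next
  case False
  then obtain m where m: "m \<in> N" "1 - c < \<mu> m" by auto
  \<comment> \<open>Coefficients of the linear lower bound: each weight other than
    \<open>\<mu> m\<close> is at most the remaining mass \<open>1 - \<mu> m\<close>, so its
    logarithm may be replaced by that of the whole remainder.\<close>
  define d where "d k = (if k = m then - log 2 (\<mu> m) else - log 2 (1 - \<mu> m))" for k
  have rest: "(\<mu> has_sum (1 - \<mu> m)) (N - {m})"
    using has_sum_Diff[OF sum has_sum_finite[of "{m}" \<mu>]] m by simp
  have "\<mu> m < 1" using le[OF m(1)] c by simp
  have small: "\<mu> k \<le> 1 - \<mu> m" if "k \<in> N" "k \<noteq> m" for k
    using has_sum_mono2[OF has_sum_finite[of "{k}" \<mu>] rest] that pos by (auto intro: less_imp_le)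
  have "ennreal (d m * \<mu> m + (- log 2 (1 - \<mu> m)) * (1 - \<mu> m))
        \<le> (\<Sum>\<^sub>\<infinity>k\<in>N. ennreal (- (\<mu> k * log 2 (\<mu> k))))"
  proof (rule infsum_ennreal_ge)
    have "((\<lambda>k. d k * \<mu> k) has_sum (- log 2 (1 - \<mu> m)) * (1 - \<mu> m)) (N - {m})"
      using has_sum_cmult_right[OF rest, of "- log 2 (1 - \<mu> m)"]
      by (rule has_sum_cong[THEN iffD1, rotated]) (simp add: d_def)
    then show "((\<lambda>k. d k * \<mu> k) has_sum d m * \<mu> m + (- log 2 (1 - \<mu> m)) * (1 - \<mu> m)) N"
      using has_sum_insert[of m "N - {m}" "\<lambda>k. d k * \<mu> k"] m(1)
      by (metis DiffD2 insertI1 insert_Diff)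
    fix k assume k: "k \<in> N"
    have "0 \<le> d k"
      using pos[OF m(1)] \<open>\<mu> m < 1\<close> by (simp add: d_def)
    then show "0 \<le> d k * \<mu> k"
      using pos[OF k] by simp
    have "d k \<le> - log 2 (\<mu> k)"
      using small[of k] k pos[OF k] \<open>\<mu> m < 1\<close> by (auto simp: d_def)
    then show "d k * \<mu> k \<le> - (\<mu> k * log 2 (\<mu> k))"
      using mult_right_mono[of "d k" "- log 2 (\<mu> k)" "\<mu> k"] pos[OF k] by (simp add: mult.commute)
  qed
  moreover have "d m * \<mu> m + (- log 2 (1 - \<mu> m)) * (1 - \<mu> m) = binary_entropy (\<mu> m)"
    by (simp add: d_def binary_entropy_def mult.commute)
  moreover have "binary_entropy c \<le> binary_entropy (\<mu> m)"
    using c m le by (intro binary_entropy_mono) auto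
  ultimately show ?thesis
    by (metis ennreal_leI order_trans)
qed

section \<open>The reversed heralding coin process\<close>

text \<open>A heralded 0 is the second letter of the coin word 00 and a heralded 2 that of the coin
  word 10; hence the factors \<open>1 - p\<close> and \<open>q\<close> on the coin
  probabilities.\<close>

definition herald_prob :: "real \<Rightarrow> real \<Rightarrow> nat \<Rightarrow> real" where
  "herald_prob p q a =
     (if a = 0 then q * (1 - p) / (p + q) else if a = 1 then p / (p + q)
      else if a = 2 then p * q / (p + q) else 0)"

text \<open>\<open>allowed\<close> and \<open>herald_trans\<close> refer to the forward process: \<open>b\<close> follows \<open>a\<close> there, so the
  reversed process emits \<open>a\<close> after \<open>b\<close>. A past, stored backwards, is read in forward order.\<close>

definition allowed :: "nat \<Rightarrow> nat \<Rightarrow> bool" where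
  "allowed a b \<longleftrightarrow> b = 1 \<and> a \<in> {0, 1, 2} \<or> b = 0 \<and> a \<in> {0, 2} \<or> b = 2 \<and> a = 1"

definition herald_trans :: "real \<Rightarrow> real \<Rightarrow> nat \<Rightarrow> nat \<Rightarrow> real" where
  "herald_trans p q a b =
     (if allowed a b then (if b = 2 then q else if b = 0 then 1 - p else if a = 1 then 1 - q else p)
      else 0)"

definition herald :: "(int \<Rightarrow> nat) \<Rightarrow> int \<Rightarrow> nat" where
  "herald x t = (if x t = 0 \<and> x (t - 1) \<noteq> 0 then 2 else x t)"

definition coin_symbol :: "nat \<Rightarrow> nat" where
  "coin_symbol a = (if a = 1 then 1 else 0)"

text \<open>Heralding looks one step to the left. Inside the word this neighbour is known and the
  condition becomes \<open>allowed\<close>; only the first letter constrains the coin outside the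
  word, a 0 or a 2 revealing the preceding coin value and a 1 revealing nothing.\<close>

lemma herald_word_iff:
  assumes x: "\<And>t. x t \<in> {0, 1}"
  shows "(\<forall>j\<le>n. herald x (s + int j) = v j) \<longleftrightarrow>
    v 0 \<in> {0, 1, 2} \<and> (\<forall>j<n. allowed (v j) (v (Suc j))) \<and>
    (\<forall>j\<le>n. x (s + int j) = coin_symbol (v j)) \<and>
    (v 0 = 0 \<longrightarrow> x (s - 1) = 0) \<and> (v 0 = 2 \<longrightarrow> x (s - 1) = 1)"
proof (induction n)
  case 0
  show ?case
    using x[of s] x[of "s - 1"] by (auto simp: herald_def coin_symbol_def)
next
  case (Suc n)
  have eq: "s + int (Suc n) - 1 = s + int n" by simp
  have "herald x (s + int (Suc n)) = v (Suc n) \<longleftrightarrow>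
      allowed (v n) (v (Suc n)) \<and> x (s + int (Suc n)) = coin_symbol (v (Suc n))"
    if "herald x (s + int n) = v n" "x (s + int n) = coin_symbol (v n)"
    using that x[of "s + int (Suc n)"] x[of "s + int n"]
    unfolding herald_def[of _ "s + int (Suc n)"] eq
    by (auto simp: herald_def coin_symbol_def allowed_def split: if_splits)
  with Suc show ?case
    by (auto simp: le_Suc_eq less_Suc_eq)
qed

lemma herald_range:
  assumes "\<And>t. x t \<in> {0, 1}"
  shows "herald x t \<in> {0, 1, 2}"
  using assms[of t] by (auto simp: herald_def)

section \<open>Cylinder probabilities of the coin, the heralding process and its reversal\<close>

locale heralding_coin =
  fixes p q :: real and C P :: "(int \<Rightarrow> nat) measure"
  assumes p: "0 < p" "p < 1" and q: "0 < q" "q < 1"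
    and coin: "stationary_coin p q C"
    and P_def: "P = time_reversal (heralding C)"
begin

sublocale coin: prob_space C
  using coin by (simp add: stationary_coin_def)

lemma sets_C [measurable_cong]: "sets C = sets (seq_space {0, 1})"
  using coin by (simp add: stationary_coin_def)

lemma space_seq_space: "space (seq_space A) = {x. \<forall>t. x t \<in> A}"
  by (auto simp: seq_space_def space_PiM)

lemma space_C: "space C = {x. \<forall>t. x t \<in> {0, 1}}"
  using sets_eq_imp_space_eq[OF sets_C] by (simp add: space_seq_space)

lemma measurable_coordinate: "(\<lambda>x. x t) \<in> measurable (seq_space A) (count_space UNIV)"
proof -
  have "(\<lambda>x. x t) \<in> measurable (seq_space A) (count_space A)"
    unfolding seq_space_def by (rule measurable_component_singleton) simp
  then show ?thesis
    by (rule measurable_compose) simp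
qed

lemma measurable_seq_space:
  assumes "\<And>t. (\<lambda>x. f x t) \<in> measurable M (count_space UNIV)" "\<And>x t. x \<in> space M \<Longrightarrow> f x t \<in> A"
  shows "f \<in> measurable M (seq_space A)"
  unfolding seq_space_def
proof (rule measurable_PiM_single')
  fix t
  show "(\<lambda>x. f x t) \<in> measurable M (count_space A)"
    using assms by (intro measurable_count_space_eq2_countable[THEN iffD2])
      (auto simp: measurable_count_space_eq2_countable)
qed (use assms in auto)

lemma coordinate_C [measurable]: "(\<lambda>x. x t) \<in> measurable C (count_space UNIV)"
  using measurable_coordinate by (simp cong: measurable_cong_sets add: sets_C)

lemma measurable_herald [measurable]: "(\<lambda>x. herald x t) \<in> measurable C (count_space UNIV)"
  unfolding herald_def by measurable

lemma coin_cylinder: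
  assumes "\<And>i. b i \<in> {0, 1}"
  shows "measure C {x \<in> space C. \<forall>i\<le>n. x (t + int i) = b i} =
    measure C {x \<in> space C. x t = b 0} * (\<Prod>i<n. coin_trans p q (b i) (b (Suc i)))"
  using coin assms by (simp add: stationary_coin_def)

lemma coin_shift:
  "measure C {x \<in> space C. x (t + 1) = a} = measure C {x \<in> space C. x t = a}"
proof -
  let ?S = "\<lambda>x t. x (t + 1) :: nat"
  have S: "?S \<in> measurable C C"
    unfolding measurable_cong_sets[OF refl sets_C]
    by (rule measurable_seq_space) (auto simp: space_C)
  have "measure C {x \<in> space C. x t = a} = measure (distr C C ?S) {x \<in> space C. x t = a}"
    using coin by (simp add: stationary_coin_def)
  also have "\<dots> = measure C (?S -` {x \<in> space C. x t = a} \<inter> space C)"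
    by (rule measure_distr[OF S]) measurable
  also have "?S -` {x \<in> space C. x t = a} \<inter> space C = {x \<in> space C. x (t + 1) = a}"
    by (auto simp: space_C)
  finally show ?thesis ..
qed

text \<open>\<open>stationary_coin\<close> does not list the one-time distribution: shift invariance
  together with the transition rule gives the balance equation \<open>m 0 * p = m 1 * q\<close>, and
  total mass one determines both values.\<close>

lemma coin_prob:
  "measure C {x \<in> space C. x t = 0} = q / (p + q)"
  "measure C {x \<in> space C. x t = 1} = p / (p + q)"
proof -
  define m where "m a = measure C {x \<in> space C. x t = a}" for a :: nat
  have "measure C ({x \<in> space C. x t = 0} \<union> {x \<in> space C. x t = 1}) = m 0 + m 1"
    unfolding m_def by (rule coin.finite_measure_Union) auto
  also have "{x \<in> space C. x t = 0} \<union> {x \<in> space C. x t = 1} = space C"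
    by (auto simp: space_C)
  finally have total: "m 0 + m 1 = 1"
    by (simp add: coin.prob_space)
  have step: "measure C {x \<in> space C. x t = a \<and> x (t + 1) = 0} = m a * coin_trans p q a 0"
    if "a \<in> {0, 1}" for a
  proof -
    have "{x \<in> space C. x t = a \<and> x (t + 1) = 0}
        = {x \<in> space C. \<forall>i\<le>1. x (t + int i) = (case i of 0 \<Rightarrow> a | Suc _ \<Rightarrow> 0)}"
      by (auto simp: le_Suc_eq split: nat.splits)
    then show ?thesis
      using coin_cylinder[of "\<lambda>i. case i of 0 \<Rightarrow> a | Suc _ \<Rightarrow> 0" 1 t] that
      by (auto simp: m_def split: nat.splits)
  qed
  have "m 0 = measure C {x \<in> space C. x (t + 1) = 0}"
    by (simp add: coin_shift m_def)
  also have "{x \<in> space C. x (t + 1) = 0} =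
      {x \<in> space C. x t = 0 \<and> x (t + 1) = 0} \<union> {x \<in> space C. x t = 1 \<and> x (t + 1) = 0}"
    by (auto simp: space_C)
  also have "measure C \<dots> = m 0 * (1 - p) + m 1 * q"
    by (subst coin.finite_measure_Union) (auto simp: step, simp add: coin_trans_def)
  finally have "m 0 * p = m 1 * q"
    by (simp add: algebra_simps)
  with total have "m 0 * (p + q) = q" "m 1 * (p + q) = p"
    by algebra+
  with p q show "measure C {x \<in> space C. x t = 0} = q / (p + q)"
    "measure C {x \<in> space C. x t = 1} = p / (p + q)"
    unfolding m_def[symmetric] by (simp_all add: field_simps)
qed

text \<open>Decoding turns a legal word into a coin cylinder. A word starting with 1 keeps its
  length; one starting with 0 or 2 gains the preceding coin letter, and the first coin transition is
  then absorbed into \<open>herald_prob\<close>. An illegal word gives an empty event and a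
  vanishing factor.\<close>

lemma herald_cylinder:
  "measure C {x \<in> space C. \<forall>j\<le>n. herald x (s + int j) = v j} =
   herald_prob p q (v 0) * (\<Prod>j<n. herald_trans p q (v j) (v (Suc j)))"
proof (cases "v 0 \<in> {0, 1, 2} \<and> (\<forall>j<n. allowed (v j) (v (Suc j)))")
  case False
  then have "{x \<in> space C. \<forall>j\<le>n. herald x (s + int j) = v j} = {}"
    using herald_word_iff[of _ n s v] unfolding space_C by blast
  moreover have "herald_prob p q (v 0) * (\<Prod>j<n. herald_trans p q (v j) (v (Suc j))) = 0"
  proof (cases "v 0 \<in> {0, 1, 2}")
    case True
    with False obtain j where "j < n" "herald_trans p q (v j) (v (Suc j)) = 0"
      by (auto simp: herald_trans_def)
    then show ?thesis by auto
  qed (simp add: herald_prob_def)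
  ultimately show ?thesis by (metis measure_empty)
next
  case True
  let ?b = "\<lambda>j. coin_symbol (v j)"
  have b: "?b j \<in> {0, 1}" for j by (simp add: coin_symbol_def)
  have prod: "(\<Prod>j<n. coin_trans p q (?b j) (?b (Suc j))) = (\<Prod>j<n. herald_trans p q (v j) (v (Suc j)))"
  proof (rule prod.cong)
    fix j assume "j \<in> {..<n}"
    with True have "allowed (v j) (v (Suc j))" by simp
    then show "coin_trans p q (?b j) (?b (Suc j)) = herald_trans p q (v j) (v (Suc j))"
      by (auto simp: coin_trans_def herald_trans_def coin_symbol_def allowed_def)
  qed simp
  have iff: "(\<forall>j\<le>n. herald x (s + int j) = v j) \<longleftrightarrow> (\<forall>j\<le>n. x (s + int j) = ?b j) \<and>
      (v 0 = 0 \<longrightarrow> x (s - 1) = 0) \<and> (v 0 = 2 \<longrightarrow> x (s - 1) = 1)" if "x \<in> space C" for x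
    using herald_word_iff[of x n s v] True that by (auto simp: space_C)
  show ?thesis
  proof (cases "v 0 = 1")
    case v0: True
    have "{x \<in> space C. \<forall>j\<le>n. herald x (s + int j) = v j}
        = {x \<in> space C. \<forall>j\<le>n. x (s + int j) = ?b j}"
      using iff v0 by auto
    then show ?thesis
      using coin_cylinder[of ?b n s, OF b] coin_prob(2)[of s] prod v0
      by (simp add: herald_prob_def coin_symbol_def[of "Suc 0"])
  next
    case v0: False
    \<comment> \<open>The coin letter at time \<open>s - 1\<close> that the first heralded symbol
      reveals: 0 before a 0, 1 before a 2.\<close>
    define a :: nat where "a = (if v 0 = 0 then 0 else 1)"
    have word: "(\<forall>i\<le>Suc n. x (s - 1 + int i) = case_nat a ?b i) \<longleftrightarrow>
        x (s - 1) = a \<and> (\<forall>j\<le>n. x (s + int j) = ?b j)" for x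
      by (auto simp: All_less_Suc2 less_Suc_eq_le[symmetric] simp del: of_nat_Suc)
         (simp_all add: algebra_simps)
    have "{x \<in> space C. \<forall>j\<le>n. herald x (s + int j) = v j}
        = {x \<in> space C. \<forall>i\<le>Suc n. x (s - 1 + int i) = case_nat a ?b i}"
    proof (intro Collect_cong conj_cong refl)
      fix x assume "x \<in> space C"
      from iff[OF this] show "(\<forall>j\<le>n. herald x (s + int j) = v j) \<longleftrightarrow>
          (\<forall>i\<le>Suc n. x (s - 1 + int i) = case_nat a ?b i)"
        unfolding word using v0 True by (auto simp: a_def)
    qed
    moreover have "case_nat a ?b i \<in> {0, 1}" for i
      using b by (auto simp: a_def split: nat.split)
    ultimately have "measure C {x \<in> space C. \<forall>j\<le>n. herald x (s + int j) = v j}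
        = measure C {x \<in> space C. x (s - 1) = a} * (coin_trans p q a (?b 0) *
            (\<Prod>j<n. coin_trans p q (?b j) (?b (Suc j))))"
      using coin_cylinder[of "case_nat a ?b" "Suc n" "s - 1"]
      by (simp add: prod.lessThan_Suc_shift del: prod.lessThan_Suc)
    also have "measure C {x \<in> space C. x (s - 1) = a} * coin_trans p q a (?b 0) = herald_prob p q (v 0)"
      using True v0 coin_prob[of "s - 1"]
      by (auto simp: a_def herald_prob_def coin_trans_def coin_symbol_def)
    ultimately show ?thesis
      by (simp add: prod mult.assoc[symmetric])
  qed
qed

lemma P_eq: "P = distr C (seq_space {0, 1, 2}) (\<lambda>x t. herald x (- (t + 1)))"
proof -
  let ?H = "seq_space {0, 1, 2}"
  have 1: "herald \<in> measurable C ?H"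
    by (rule measurable_seq_space[OF measurable_herald herald_range]) (simp add: space_C)
  have 2: "(\<lambda>x t. x (- (t + 1))) \<in> measurable ?H ?H"
    by (rule measurable_seq_space) (auto simp: space_seq_space intro: measurable_coordinate)
  have "P = distr (distr C ?H herald) ?H (\<lambda>x t. x (- (t + 1)))"
    unfolding P_def time_reversal_def heralding_def herald_def[abs_def, symmetric]
    by (rule distr_cong) auto
  also have "\<dots> = distr C ?H ((\<lambda>x t. x (- (t + 1))) \<circ> herald)"
    by (rule distr_distr[OF 2 1])
  finally show ?thesis by (simp add: comp_def)
qed

lemma measurable_reversed:
  "(\<lambda>x t. herald x (- (t + 1))) \<in> measurable C (seq_space {0, 1, 2})"
  by (rule measurable_seq_space[OF measurable_herald herald_range]) (simp add: space_C)

sublocale rev: prob_space P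
  unfolding P_eq by (rule coin.prob_space_distr[OF measurable_reversed])

lemma sets_P [measurable_cong]: "sets P = sets (seq_space {0, 1, 2})"
  by (simp add: P_eq)

lemma space_P: "space P = {x. \<forall>t. x t \<in> {0, 1, 2}}"
  using sets_eq_imp_space_eq[OF sets_P] by (simp add: space_seq_space)

lemma coordinate_P [measurable]: "(\<lambda>x. x t) \<in> measurable P (count_space UNIV)"
  using measurable_coordinate by (simp cong: measurable_cong_sets add: sets_P)

text \<open>The times \<open>t - int i\<close> run backwards, which is the forward direction of the
  coin, so the product is again that of the forward chain.\<close>

lemma cylinder:
  "measure P {x \<in> space P. \<forall>i\<le>n. x (t - int i) = v i} =
   herald_prob p q (v 0) * (\<Prod>i<n. herald_trans p q (v i) (v (Suc i)))"
proof -
  let ?E = "{x \<in> space P. \<forall>i\<le>n. x (t - int i) = v i}"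
  let ?f = "\<lambda>x t. herald x (- (t + 1))"
  have "?E \<in> sets P" by measurable
  then have E: "?E \<in> sets (seq_space {0, 1, 2})" by (simp only: sets_P)
  have "measure P ?E = measure C (?f -` ?E \<inter> space C)"
    using measure_distr[OF measurable_reversed E] unfolding P_eq[symmetric] .
  also have "?f -` ?E \<inter> space C = {x \<in> space C. \<forall>i\<le>n. ?f x (t - int i) = v i}"
    using herald_range unfolding space_P space_C by blast
  also have "\<dots> = {x \<in> space C. \<forall>i\<le>n. herald x (- (t + 1) + int i) = v i}"
    by (simp add: algebra_simps)
  finally show ?thesis
    by (simp only: herald_cylinder)
qed

section \<open>Pasts, conditional futures and causal states\<close>

lemma herald_prob_pos: "0 < herald_prob p q a \<longleftrightarrow> a \<in> {0, 1, 2}"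
  using p q by (auto simp: herald_prob_def)

lemma herald_trans_pos: "0 < herald_trans p q a b \<longleftrightarrow> allowed a b"
  using p q by (auto simp: herald_trans_def)

text \<open>The word \<open>v\<close> starts at the last future symbol and runs back into the past,
  the direction in which \<open>cylinder\<close> multiplies transitions; the future word is
  therefore reversed, while the past is already stored in this order.\<close>

lemma recent_future:
  assumes "length w + L = Suc n"
  shows "measure P {x \<in> recent P h L. \<forall>i<length w. x (int i) = w ! i} =
    (let v = (\<lambda>i. if i < length w then w ! (length w - 1 - i) else h (i - length w))
     in herald_prob p q (v 0) * (\<Prod>i<n. herald_trans p q (v i) (v (Suc i))))"
proof -
  define m where "m = length w"
  define v where "v = (\<lambda>i. if i < m then w ! (m - 1 - i) else h (i - m))"
  have "(\<forall>k<L. past x k = h k) \<and> (\<forall>i<m. x (int i) = w ! i) \<longleftrightarrow>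
      (\<forall>i\<le>n. x (int m - 1 - int i) = v i)" for x
  proof safe
    fix i assume *: "\<forall>k<L. past x k = h k" "\<forall>i<m. x (int i) = w ! i" "i \<le> n"
    show "x (int m - 1 - int i) = v i"
    proof (cases "i < m")
      case True
      then have "x (int (m - 1 - i)) = w ! (m - 1 - i)" by (intro *(2)[rule_format]) simp
      moreover have "int (m - 1 - i) = int m - 1 - int i" using True by auto
      moreover have "v i = w ! (m - 1 - i)" using True by (simp add: v_def)
      ultimately show ?thesis by (simp only:)
    next
      case False
      with * assms have "past x (i - m) = h (i - m)" by (auto simp: m_def)
      with False show ?thesis by (simp add: v_def past_def algebra_simps)
    qed
  next
    fix k assume *: "\<forall>i\<le>n. x (int m - 1 - int i) = v i" "k < L"
    with assms have "x (int m - 1 - int (m + k)) = v (m + k)"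
      by (intro *(1)[rule_format]) (simp add: m_def)
    then show "past x k = h k" by (simp add: v_def past_def)
  next
    fix i assume *: "\<forall>i\<le>n. x (int m - 1 - int i) = v i" "i < m"
    with assms have "x (int m - 1 - int (m - 1 - i)) = v (m - 1 - i)"
      by (intro *(1)[rule_format]) (simp add: m_def)
    then show "x (int i) = w ! i" using *(2) by (simp add: v_def)
  qed
  then have "{x \<in> recent P h L. \<forall>i<length w. x (int i) = w ! i}
      = {x \<in> space P. \<forall>i\<le>n. x (int m - 1 - int i) = v i}"
    by (auto simp: recent_def m_def)
  then have "measure P {x \<in> recent P h L. \<forall>i<length w. x (int i) = w ! i} =
      herald_prob p q (v 0) * (\<Prod>i<n. herald_trans p q (v i) (v (Suc i)))"
    by (simp only: cylinder)
  then show ?thesis unfolding v_def m_def Let_def .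
qed

lemma recent_prob:
  "measure P (recent P h (Suc n)) = herald_prob p q (h 0) * (\<Prod>i<n. herald_trans p q (h i) (h (Suc i)))"
  using recent_future[of "[]" "Suc n" n h] by simp

lemma pasts_iff: "h \<in> pasts P \<longleftrightarrow> h 0 \<in> {0, 1, 2} \<and> (\<forall>j. allowed (h j) (h (Suc j)))"
proof
  assume "h \<in> pasts P"
  then have *: "0 < measure P (recent P h (Suc n))" for n
    by (simp add: pasts_def)
  have "h 0 \<in> {0, 1, 2}"
    using *[of 0] herald_prob_pos[of "h 0"] by (simp add: recent_prob)
  moreover have "allowed (h j) (h (Suc j))" for j
  proof (rule ccontr)
    assume "\<not> ?thesis"
    then have "(\<Prod>i<Suc j. herald_trans p q (h i) (h (Suc i))) = 0"
      by (simp add: herald_trans_def)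
    with *[of "Suc j"] show False
      by (simp only: recent_prob)
  qed
  ultimately show "h 0 \<in> {0, 1, 2} \<and> (\<forall>j. allowed (h j) (h (Suc j)))" by blast
next
  assume h: "h 0 \<in> {0, 1, 2} \<and> (\<forall>j. allowed (h j) (h (Suc j)))"
  have "0 < measure P (recent P h L)" for L
  proof (cases L)
    case 0
    then show ?thesis by (simp add: recent_def rev.prob_space)
  next
    case (Suc n)
    with h show ?thesis
      by (auto simp only: recent_prob herald_prob_pos herald_trans_pos
            intro!: mult_pos_pos prod_pos)
  qed
  then show "h \<in> pasts P" by (simp add: pasts_def)
qed

text \<open>The transitions inside the past cancel, so the quotient is the same for every
  \<open>L\<close> of the form \<open>Suc n\<close> and the limit is that constant;
  \<open>L = 0\<close>, where nothing is conditioned on, is skipped by shifting the index. Only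
  \<open>h 0\<close> survives, which is the Markov property of the reversed process.\<close>

lemma cond_future_eq:
  assumes "h \<in> pasts P"
  shows "cond_future P h w =
    (let m = length w; v = (\<lambda>i. if i < m then w ! (m - 1 - i) else h 0)
     in herald_prob p q (v 0) * (\<Prod>i<m. herald_trans p q (v i) (v (Suc i))) / herald_prob p q (h 0))"
proof -
  define m where "m = length w"
  define v where "v = (\<lambda>i. if i < m then w ! (m - 1 - i) else h 0)"
  \<comment> \<open>\<open>u\<close> continues into the true past, whereas \<open>v\<close> repeats
    \<open>h 0\<close>; they agree up to index \<open>m\<close>, which is as far as the transitions
    into the future word reach.\<close>
  define u where "u = (\<lambda>i. if i < m then w ! (m - 1 - i) else h (i - m))"
  let ?c = "herald_prob p q (v 0) * (\<Prod>i<m. herald_trans p q (v i) (v (Suc i))) / herald_prob p q (h 0)"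
  have "measure P {x \<in> recent P h (Suc n). \<forall>i<length w. x (int i) = w ! i}
      / measure P (recent P h (Suc n)) = ?c" for n
  proof -
    let ?R = "\<Prod>i<n. herald_trans p q (h i) (h (Suc i))"
    have R: "?R > 0"
      using assms by (intro prod_pos) (simp add: pasts_iff herald_trans_pos)
    have "(\<Prod>i<m + n. herald_trans p q (u i) (u (Suc i)))
        = (\<Prod>i<m. herald_trans p q (u i) (u (Suc i))) * (\<Prod>i<n. herald_trans p q (u (m + i)) (u (Suc (m + i))))"
      by (induction n) (simp_all add: mult.assoc)
    also have "(\<Prod>i<n. herald_trans p q (u (m + i)) (u (Suc (m + i)))) = ?R"
      by (simp add: u_def)
    also have "(\<Prod>i<m. herald_trans p q (u i) (u (Suc i))) = (\<Prod>i<m. herald_trans p q (v i) (v (Suc i)))"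
    proof (rule prod.cong)
      fix i assume i: "i \<in> {..<m}"
      then have "u (Suc i) = v (Suc i)"
        by (cases "Suc i = m") (auto simp: u_def v_def)
      with i show "herald_trans p q (u i) (u (Suc i)) = herald_trans p q (v i) (v (Suc i))"
        by (simp add: u_def v_def)
    qed simp
    finally have *: "(\<Prod>i<m + n. herald_trans p q (u i) (u (Suc i)))
        = (\<Prod>i<m. herald_trans p q (v i) (v (Suc i))) * ?R" .
    have "measure P {x \<in> recent P h (Suc n). \<forall>i<length w. x (int i) = w ! i}
        = herald_prob p q (u 0) * (\<Prod>i<m + n. herald_trans p q (u i) (u (Suc i)))"
      using recent_future[of w "Suc n" "m + n" h] unfolding u_def m_def Let_def by simp
    also have "u 0 = v 0" by (simp add: u_def v_def)
    finally show ?thesis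
      unfolding * recent_prob mult.assoc[symmetric]
      by (simp only: mult_divide_mult_cancel_right[OF less_imp_neq[OF R, symmetric]])
  qed
  then have lim: "(\<lambda>L. measure P {x \<in> recent P h L. \<forall>i<length w. x (int i) = w ! i}
      / measure P (recent P h L)) \<longlonglongrightarrow> ?c"
    by (subst filterlim_sequentially_Suc[symmetric]) simp
  show ?thesis
    unfolding cond_future_def limI[OF lim] unfolding v_def m_def Let_def ..
qed

lemma cond_future_symbol:
  assumes "h \<in> pasts P"
  shows "cond_future P h [y] = herald_prob p q y * herald_trans p q y (h 0) / herald_prob p q (h 0)"
  by (simp add: cond_future_eq[OF assms])

lemma cond_future_symbol_pos:
  assumes "h \<in> pasts P"
  shows "0 < cond_future P h [y] \<longleftrightarrow> allowed y (h 0)"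
proof -
  have "h 0 \<in> {0, 1, 2}" using assms by (simp add: pasts_iff)
  then have "0 < herald_prob p q (h 0)" using herald_prob_pos by blast
  moreover have "0 < herald_prob p q y" if "allowed y (h 0)"
    using that unfolding herald_prob_pos by (auto simp: allowed_def)
  ultimately show ?thesis
    using herald_trans_pos[of y "h 0"]
    by (auto simp: cond_future_symbol[OF assms] zero_less_divide_iff zero_less_mult_iff
        herald_trans_def split: if_splits)
qed

lemma cond_future_table:
  assumes "h \<in> pasts P"
  shows "h 0 = 0 \<Longrightarrow> cond_future P h [0] = 1 - p"
    "h 0 = 0 \<Longrightarrow> cond_future P h [1] = 0"
    "h 0 = 0 \<Longrightarrow> cond_future P h [2] = p"
    "h 0 = 1 \<Longrightarrow> cond_future P h [0] = q * (1 - p)"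
    "h 0 = 1 \<Longrightarrow> cond_future P h [1] = 1 - q"
    "h 0 = 1 \<Longrightarrow> cond_future P h [2] = q * p"
    "h 0 = 2 \<Longrightarrow> cond_future P h [0] = 0"
    "h 0 = 2 \<Longrightarrow> cond_future P h [1] = 1"
    "h 0 = 2 \<Longrightarrow> cond_future P h [2] = 0"
  using p q
  by (simp_all add: cond_future_symbol[OF assms] herald_prob_def herald_trans_def allowed_def)

lemma extended_past:
  assumes "h \<in> pasts P" "0 < cond_future P h [y]"
  shows "case_nat y h \<in> pasts P"
  using assms(2) cond_future_symbol_pos[OF assms(1)] assms(1)
  by (auto simp: pasts_iff allowed_def split: nat.splits)

lemma past_with_symbol:
  assumes "j \<in> {0, 1, 2}"
  shows "\<exists>h\<in>pasts P. h 0 = j"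
proof -
  \<comment> \<open>Each of the three symbols may stand before a 1 in forward order, so any last
    symbol can be put on the all-ones past.\<close>
  have "case_nat j (\<lambda>_. 1) \<in> pasts P"
    using assms by (auto simp: pasts_iff allowed_def split: nat.splits)
  then show ?thesis by (rule bexI[rotated]) simp
qed

lemma causal_states_eq:
  "causal_states P = {{h \<in> pasts P. h 0 = 0}, {h \<in> pasts P. h 0 = 1}, {h \<in> pasts P. h 0 = 2}}"
proof -
  let ?R = "{(h, h'). h \<in> pasts P \<and> h' \<in> pasts P \<and> (\<forall>w. cond_future P h w = cond_future P h' w)}"
  have same: "(\<forall>w. cond_future P h w = cond_future P h' w) \<longleftrightarrow> h 0 = h' 0"
    if h: "h \<in> pasts P" "h' \<in> pasts P" for h h'
  proof
    assume *: "\<forall>w. cond_future P h w = cond_future P h' w"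
    have "h 0 \<in> {0, 1, 2}" "h' 0 \<in> {0, 1, 2}" using h by (simp_all add: pasts_iff)
    \<comment> \<open>The one-letter word 1 separates the classes: its probabilities 0,
      \<open>1 - q\<close> and 1 are distinct since \<open>0 < q < 1\<close>.\<close>
    then show "h 0 = h' 0"
      using *[rule_format, of "[1]"] cond_future_table[OF h(1)] cond_future_table[OF h(2)] p q
      by auto
  next
    assume "h 0 = h' 0"
    then show "\<forall>w. cond_future P h w = cond_future P h' w"
      by (simp only: cond_future_eq h simp_thms)
  qed
  have "?R `` {h} = {h' \<in> pasts P. h' 0 = h 0}" if "h \<in> pasts P" for h
    using same that by fastforce
  then have "causal_states P = (\<lambda>h. {h' \<in> pasts P. h' 0 = h 0}) ` pasts P"
    unfolding causal_states_def quotient_def by auto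
  also have "\<dots> = (\<lambda>j. {h' \<in> pasts P. h' 0 = j}) ` (\<lambda>h. h 0) ` pasts P"
    by (simp only: image_image)
  also have "(\<lambda>h. h 0) ` pasts P = {0, 1, 2}"
  proof
    show "(\<lambda>h. h 0) ` pasts P \<subseteq> {0, 1, 2}"
      by (rule image_subsetI) (simp add: pasts_iff)
    show "{0, 1, 2} \<subseteq> (\<lambda>h. h 0) ` pasts P"
    proof
      fix j :: nat assume "j \<in> {0, 1, 2}"
      then have "\<exists>h\<in>pasts P. h 0 = j" by (rule past_with_symbol)
      then obtain h where "h \<in> pasts P" "h 0 = j" by (rule bexE)
      then show "j \<in> (\<lambda>h. h 0) ` pasts P" by (intro image_eqI) simp_all
    qed
  qed
  finally show ?thesis by simp
qed

section \<open>Integration over the pasts\<close>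

definition past_event :: "(int \<Rightarrow> nat) set" where
  "past_event = {x \<in> space P. past x \<in> pasts P}"

lemma past_event_sets [measurable]: "past_event \<in> sets P"
proof -
  have "past_event = {x \<in> space P. (x (- 1) = 0 \<or> x (- 1) = 1 \<or> x (- 1) = 2) \<and>
      (\<forall>j. x (- 1 - int (Suc j)) = 1 \<and>
             (x (- 1 - int j) = 0 \<or> x (- 1 - int j) = 1 \<or> x (- 1 - int j) = 2) \<or>
           x (- 1 - int (Suc j)) = 0 \<and> (x (- 1 - int j) = 0 \<or> x (- 1 - int j) = 2) \<or>
           x (- 1 - int (Suc j)) = 2 \<and> x (- 1 - int j) = 1)}"
    by (auto simp: past_event_def pasts_iff past_def allowed_def)
  also have "\<dots> \<in> sets P" by measurable
  finally show ?thesis .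
qed

text \<open>A trajectory can only leave the event through a forbidden pair of neighbours, and there
  are countably many times and pairs, each of probability zero.\<close>

lemma AE_past_event: "AE x in P. x \<in> past_event"
proof -
  have null: "AE x in P. \<not> (x t = a \<and> x (t - 1) = b)" if "\<not> allowed a b" for t a b
  proof -
    have "{x \<in> space P. x t = a \<and> x (t - 1) = b}
        = {x \<in> space P. \<forall>i\<le>1. x (t - int i) = (case i of 0 \<Rightarrow> a | Suc _ \<Rightarrow> b)}"
      by (auto simp: le_Suc_eq split: nat.splits)
    then have "measure P {x \<in> space P. x t = a \<and> x (t - 1) = b} = 0"
      using cylinder[of 1 t "\<lambda>i. case i of 0 \<Rightarrow> a | Suc _ \<Rightarrow> b"] that by (simp add: herald_trans_def)
    then show ?thesis
      by (subst (asm) rev.prob_eq_0) auto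
  qed
  then have "AE x in P. \<forall>t a b. \<not> allowed a b \<longrightarrow> \<not> (x t = a \<and> x (t - 1) = b)"
    unfolding AE_all_countable using null by (auto intro: AE_I2)
  then show ?thesis
  proof (rule AE_mp, intro AE_I2 impI)
    fix x assume x: "x \<in> space P" and *: "\<forall>t a b. \<not> allowed a b \<longrightarrow> \<not> (x t = a \<and> x (t - 1) = b)"
    have "allowed (past x j) (past x (Suc j))" for j
      using *[rule_format, of "past x j" "past x (Suc j)" "- 1 - int j"]
      by (auto simp: past_def algebra_simps)
    with x show "x \<in> past_event"
      by (auto simp: past_event_def pasts_iff space_P past_def)
  qed
qed

text \<open>Serves both sides of the comparison: it evaluates the memory state of the proposed
  model, and it integrates the bounds on a competitor, which depend on the last symbol only.\<close>

lemma integral_last_symbol: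
  fixes f :: "nat \<Rightarrow> 'b :: {banach, second_countable_topology}"
  shows "integrable P (\<lambda>x. indicator past_event x *\<^sub>R f (past x 0))"
    and "(LINT x|P. indicator past_event x *\<^sub>R f (past x 0)) = (\<Sum>j\<in>{0, 1, 2}. herald_prob p q j *\<^sub>R f j)"
proof -
  let ?E = "\<lambda>j. {x \<in> space P. x (- 1) = j}"
  let ?s = "\<lambda>x. \<Sum>j\<in>{0, 1, 2}. indicator (?E j) x *\<^sub>R f j"
  have E: "?E j \<in> sets P" for j by measurable
  have prob: "measure P (?E j) = herald_prob p q j" for j
    using cylinder[of 0 "- 1" "\<lambda>_. j"] by simp
  have 1: "(\<lambda>x. indicator past_event x *\<^sub>R f (past x 0)) \<in> borel_measurable P"
    unfolding past_def by measurable
  have range: "AE x in P. x (- 1) \<in> {0, 1, 2}"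
    by (rule AE_I2) (simp only: space_P mem_Collect_eq)
  have 2: "AE x in P. ?s x = indicator past_event x *\<^sub>R f (past x 0)"
    using AE_past_event range AE_space
    by eventually_elim (auto simp: past_def indicator_def)
  have iE: "integrable P (indicator (?E j) :: _ \<Rightarrow> real)" for j
    by (rule integrable_real_indicator[OF E]) (simp add: less_top[symmetric])
  then have I: "integrable P (\<lambda>x. indicator (?E j) x *\<^sub>R f j)" for j
    by (intro integrable_scaleR_left)
  have S: "integrable P ?s" by (rule Bochner_Integration.integrable_sum) (rule I)
  have eq: "AE x in P. indicator past_event x *\<^sub>R f (past x 0) = ?s x"
    using 2 by eventually_elim (rule sym)
  show "integrable P (\<lambda>x. indicator past_event x *\<^sub>R f (past x 0))"
    by (rule integrable_cong_AE_imp[OF S 1 2])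
  have "(LINT x|P. indicator past_event x *\<^sub>R f (past x 0)) = (LINT x|P. ?s x)"
    by (rule integral_cong_AE[OF 1 borel_measurable_integrable[OF S] eq])
  also have "\<dots> = (\<Sum>j\<in>{0, 1, 2}. LINT x|P. indicator (?E j) x *\<^sub>R f j)"
    by (rule Bochner_Integration.integral_sum) (rule I)
  also have "\<dots> = (\<Sum>j\<in>{0, 1, 2}. herald_prob p q j *\<^sub>R f j)"
  proof (rule sum.cong[OF refl])
    fix j
    have "(LINT x|P. indicator (?E j) x *\<^sub>R f j) = (LINT x|P. indicator (?E j) x) *\<^sub>R f j"
      by (rule integral_scaleR_left) (rule iE)
    also have "(LINT x|P. indicator (?E j) x) = measure P (?E j)"
      using E[of j] by (simp add: sets.Int_space_eq2)
    finally show "(LINT x|P. indicator (?E j) x *\<^sub>R f j) = herald_prob p q j *\<^sub>R f j"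
      by (simp only: prob)
  qed
  finally show "(LINT x|P. indicator past_event x *\<^sub>R f (past x 0)) = (\<Sum>j\<in>{0, 1, 2}. herald_prob p q j *\<^sub>R f j)" .
qed

end

section \<open>The largest eigenvalue of the memory state\<close>

text \<open>Among the symbols 0, 1, 2 the sums 1 and 3 of distinct indices single out the pairs {0,
  1} and {1, 2}. The diagonal value is the trivial bound, since equal causal states may have
  different encodings. For the proposed kets this is exactly the Gram matrix.\<close>

definition overlap_bound :: "real \<Rightarrow> nat \<Rightarrow> nat \<Rightarrow> real" where
  "overlap_bound q i j =
     (if i = j then 1 else if i + j = 1 then sqrt q else if i + j = 3 then sqrt (1 - q) else 0)"

text \<open>Exchanges the integral over pasts with series over basis indices: partial inner products
  of unit vectors are bounded by 1 through Cauchy-Schwarz. Measurability of the limit is a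
  conclusion, as a model guarantees it only for products of two coordinates.\<close>

lemma dominated_by_1:
  fixes s :: "nat \<Rightarrow> 'a \<Rightarrow> complex"
  assumes "prob_space M" "\<And>n. s n \<in> borel_measurable M"
    and "\<And>x. x \<in> space M \<Longrightarrow> (\<lambda>n. s n x) \<longlonglongrightarrow> f x"
    and "\<And>n x. x \<in> space M \<Longrightarrow> cmod (s n x) \<le> 1"
  shows "f \<in> borel_measurable M" "integrable M f" "(\<lambda>n. \<integral>x. s n x \<partial>M) \<longlonglongrightarrow> (\<integral>x. f x \<partial>M)"
proof -
  interpret prob_space M by fact
  show f: "f \<in> borel_measurable M"
    by (rule borel_measurable_LIMSEQ_metric[OF assms(2,3)])
  note DC = f assms(2) integrable_const[of "1 :: real"] AE_I2[OF assms(3)] AE_I2[OF assms(4)]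
  show "integrable M f" "(\<lambda>n. \<integral>x. s n x \<partial>M) \<longlonglongrightarrow> (\<integral>x. f x \<partial>M)"
    by (rule integrable_dominated_convergence[OF DC] integral_dominated_convergence[OF DC]; assumption)+
qed

section \<open>Consequences of a spectral decomposition\<close>

lemma spectral_unit:
  assumes "spectral_decomposition \<rho> N \<mu> e" "k \<in> N"
  shows "e k \<in> ell2 UNIV" "0 < \<mu> k" "norm_sq (e k) = 1"
proof -
  show *: "e k \<in> ell2 UNIV" "0 < \<mu> k" using assms by (auto simp: spectral_decomposition_def)
  have "ket_inner (e k) (e k) = 1" using assms by (simp add: spectral_decomposition_def)
  then show "norm_sq (e k) = 1" using ket_inner_self[OF *(1)] of_real_eq_1_iff by metis
qed

text \<open>The non-negative family \<open>\<mu> k * (cmod (e k a))\<^sup>2\<close> is summed in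
  both orders: over \<open>k\<close> first it gives the diagonal of \<open>\<rho>\<close>, over
  \<open>a\<close> first the eigenvalues, because each \<open>e k\<close> has norm one.\<close>

lemma spectral_trace:
  assumes spec: "spectral_decomposition \<rho> N \<mu> e"
    and tr: "((\<lambda>a. Re (\<rho> a a)) has_sum 1) UNIV"
  shows "(\<mu> has_sum 1) N"
proof -
  note e = spectral_unit[OF spec]
  have row: "((\<lambda>k. case (a, k) of (a, k) \<Rightarrow> \<mu> k * (cmod (e k a))\<^sup>2) has_sum Re (\<rho> a a)) N" for a
  proof -
    have "((\<lambda>k. complex_of_real (\<mu> k) * (e k a * cnj (e k a))) has_sum \<rho> a a) N"
      using spec by (simp add: spectral_decomposition_def)
    from has_sum_Re[OF this] show ?thesis
      by (simp add: complex_mult_cnj cmod_power2)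
  qed
  have "((\<lambda>(a, k). \<mu> k * (cmod (e k a))\<^sup>2) has_sum 1) (UNIV \<times> N)"
    by (rule has_sum_SigmaI[OF row tr summable_on_SigmaI[OF row has_sum_imp_summable[OF tr]]])
       (auto simp: less_imp_le[OF e(2)])
  then have "((\<lambda>(k, a). \<mu> k * (cmod (e k a))\<^sup>2) has_sum 1) (N \<times> UNIV)"
    by (subst has_sum_swap) simp
  then show ?thesis
  proof (rule has_sum_SigmaD)
    fix k assume k: "k \<in> N"
    have "((\<lambda>a. \<mu> k * (cmod (e k a))\<^sup>2) has_sum \<mu> k * norm_sq (e k)) UNIV"
      by (intro has_sum_cmult_right norm_sq_has_sum[OF e(1)[OF k]])
    then show "((\<lambda>a. case (k, a) of (k, a) \<Rightarrow> \<mu> k * (cmod (e k a))\<^sup>2) has_sum \<mu> k) UNIV"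
      by (simp add: e(3)[OF k])
  qed
qed

text \<open>Orthonormality collapses the sum over \<open>l\<close> once the sum over
  \<open>b\<close> has been carried out first. The exchange needs absolute convergence: |xy| \<le>
  x^2 + y^2 and the bound 1 on coordinates give a majorant whose rows sum to
  \<open>\<mu> l * 2\<close>, and the eigenvalues are summable.\<close>

lemma spectral_eigenvector:
  assumes spec: "spectral_decomposition \<rho> N \<mu> e"
    and sum: "(\<mu> has_sum 1) N" and k: "k \<in> N"
  shows "((\<lambda>b. \<rho> a b * e k b) has_sum complex_of_real (\<mu> k) * e k a) UNIV"
proof -
  note e = spectral_unit[OF spec]
  define f where "f l b = complex_of_real (\<mu> l) * (e l a * (cnj (e l b) * e k b))" for l b
  have row: "((\<lambda>b. case (l, b) of (l, b) \<Rightarrow> \<mu> l * ((cmod (e l b))\<^sup>2 + (cmod (e k b))\<^sup>2)) has_sum \<mu> l * 2) UNIV"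
    if l: "l \<in> N" for l
  proof -
    have "((\<lambda>b. \<mu> l * ((cmod (e l b))\<^sup>2 + (cmod (e k b))\<^sup>2)) has_sum \<mu> l * (norm_sq (e l) + norm_sq (e k))) UNIV"
      by (intro has_sum_cmult_right has_sum_add norm_sq_has_sum[OF e(1)] l k)
    then show ?thesis by (simp add: e(3) l k)
  qed
  have "(\<lambda>(l, b). \<mu> l * ((cmod (e l b))\<^sup>2 + (cmod (e k b))\<^sup>2)) summable_on N \<times> UNIV"
    by (rule summable_on_SigmaI[OF row summable_on_cmult_left[OF has_sum_imp_summable[OF sum]]])
       (auto simp: less_imp_le[OF e(2)])
  then have "(\<lambda>lb. norm (case lb of (l, b) \<Rightarrow> f l b)) summable_on N \<times> UNIV"
  proof (rule summable_on_comparison_test; clarify)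
    fix l b assume l: "l \<in> N"
    have "cmod (e l a) * (cmod (e l b) * cmod (e k b)) \<le> 1 * (cmod (e l b) * cmod (e k b))"
      by (intro mult_right_mono cmod_le_1[OF e(1,3)] l) simp
    also have "\<dots> \<le> (cmod (e l b))\<^sup>2 + (cmod (e k b))\<^sup>2"
    proof -
      have "0 \<le> cmod (e l b) * cmod (e k b)" by simp
      with sum_squares_bound[of "cmod (e l b)" "cmod (e k b)"] show ?thesis by linarith
    qed
    finally show "norm (f l b) \<le> \<mu> l * ((cmod (e l b))\<^sup>2 + (cmod (e k b))\<^sup>2)"
      using e(2)[OF l] by (simp add: f_def norm_mult)
  qed simp
  then have "((\<lambda>(l, b). f l b) has_sum infsum (\<lambda>(l, b). f l b) (N \<times> UNIV)) (N \<times> UNIV)" (is "(_ has_sum ?S) _")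
    by (rule has_sum_infsum[OF abs_summable_summable])
  note total = this
  have "((\<lambda>l. complex_of_real (\<mu> l) * (e l a * ket_inner (e l) (e k))) has_sum ?S) N"
  proof (rule has_sum_SigmaD[OF total])
    fix l assume l: "l \<in> N"
    show "((\<lambda>b. case (l, b) of (l, b) \<Rightarrow> f l b) has_sum complex_of_real (\<mu> l) * (e l a * ket_inner (e l) (e k))) UNIV"
      unfolding prod.case f_def
      by (intro has_sum_cmult_right ket_inner_has_sum[OF e(1) e(1)] l k)
  qed
  moreover have "((\<lambda>l. complex_of_real (\<mu> l) * (e l a * ket_inner (e l) (e k)))
      has_sum complex_of_real (\<mu> k) * e k a) N"
    by (rule has_sum_finite_neutralI[of "{k}"])
       (use spec k in \<open>auto simp: spectral_decomposition_def\<close>)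
  ultimately have S: "?S = complex_of_real (\<mu> k) * e k a"
    by (rule has_sum_unique)
  have "((\<lambda>(b, l). f l b) has_sum ?S) (UNIV \<times> N)"
    using total by (subst has_sum_swap) simp
  then show ?thesis
    unfolding S
  proof (rule has_sum_SigmaD)
    fix b
    have "((\<lambda>l. complex_of_real (\<mu> l) * (e l a * cnj (e l b)) * e k b) has_sum \<rho> a b * e k b) N"
      using spec by (intro has_sum_cmult_left) (simp add: spectral_decomposition_def)
    then show "((\<lambda>l. case (b, l) of (b, l) \<Rightarrow> f l b) has_sum \<rho> a b * e k b) N"
      by (simp add: f_def mult_ac)
  qed
qed

section \<open>Overlap bounds and the two-by-two memory state\<close>

context heralding_coin
begin

lemma model_ket:
  assumes "quantum_model A P Q" "h \<in> pasts P"
  shows "enc Q h \<in> ell2 (qbasis Q)" "norm_sq (enc Q h) = 1"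
  using assms by (auto simp: quantum_model_def)

text \<open>Causal states 0 and 1 have the symbols 0 and 2 in common, contributing
  \<open>(1 - p) * sqrt q\<close> and \<open>p * sqrt q\<close>, so \<open>p\<close> drops out of
  the total. States 1 and 2 share only the symbol 1, and states 0 and 2 share none. Pasts of one
  causal state get the Cauchy-Schwarz bound.\<close>

lemma model_overlap:
  assumes Q: "quantum_model {0, 1, 2} P Q" and h: "h \<in> pasts P" "h' \<in> pasts P"
  shows "cmod (ket_inner (enc Q h) (enc Q h')) \<le> overlap_bound q (h 0) (h' 0)"
proof (cases "h 0 = h' 0")
  case True
  then show ?thesis
    using ket_inner_bound[OF model_ket(1)[OF Q h(1)] model_ket(1)[OF Q h(2)]] model_ket(2)[OF Q] h
    by (simp add: overlap_bound_def)
next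
  case False
  have *: "((\<lambda>j. norm_sq (kraus Q y j (enc Q g))) has_sum cond_future P g [y]) UNIV"
    if "g \<in> pasts P" "y \<in> {0, 1, 2}" for g y
    using Q that unfolding quantum_model_def by blast
  have "cmod (ket_inner (enc Q h) (enc Q h')) \<le> (\<Sum>y\<in>{0, 1, 2}. sqrt (cond_future P h [y] * cond_future P h' [y]))"
    by (rule instrument_overlap[of "{0, 1, 2}" "qbasis Q" "kraus Q"])
       (use Q * h model_ket[OF Q] in \<open>auto simp: quantum_model_def\<close>)
  also have "\<dots> = sqrt (cond_future P h [0] * cond_future P h' [0])
      + sqrt (cond_future P h [1] * cond_future P h' [1]) + sqrt (cond_future P h [2] * cond_future P h' [2])"
    by simp
  also have "\<dots> = overlap_bound q (h 0) (h' 0)"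
  proof -
    have sq: "sqrt ((1 - p) * (q * (1 - p))) = (1 - p) * sqrt q" "sqrt (p * (q * p)) = p * sqrt q"
      "sqrt (q * (1 - p) * (1 - p)) = (1 - p) * sqrt q" "sqrt (q * p * p) = p * sqrt q"
      using p q by (simp_all add: real_sqrt_mult)
    have split: "(1 - p) * sqrt q + p * sqrt q = sqrt q"
      by (simp add: algebra_simps)
    have "h 0 \<in> {0, 1, 2}" "h' 0 \<in> {0, 1, 2}" using h by (simp_all only: pasts_iff)
    then consider "h 0 = 0" "h' 0 = 1" | "h 0 = 0" "h' 0 = 2" | "h 0 = 1" "h' 0 = 0"
      | "h 0 = 1" "h' 0 = 2" | "h 0 = 2" "h' 0 = 0" | "h 0 = 2" "h' 0 = 1"
      using False by auto
    then show ?thesis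
      by cases (simp_all only: cond_future_table[OF h(1)] cond_future_table[OF h(2)] overlap_bound_def,
        simp_all add: sq split)
  qed
  finally show ?thesis .
qed

text \<open>Upper left entry of the proposed density matrix in the computational basis; trace one
  makes the other diagonal entry \<open>1 - diag_entry\<close>.\<close>

definition diag_entry :: real where "diag_entry = q / (p + q)"

definition off_diag_entry :: real where "off_diag_entry = p * sqrt q * sqrt (1 - q) / (p + q)"

text \<open>Larger root of the characteristic polynomial; as the trace is one, the two roots lie
  symmetrically about 1/2.\<close>

definition max_eigenvalue :: real where
  "max_eigenvalue = 1 / 2 + sqrt ((diag_entry - 1 / 2)\<^sup>2 + off_diag_entry\<^sup>2)"

lemma off_diag_pos: "0 < off_diag_entry"
  using p q by (simp add: off_diag_entry_def)

lemma entries: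
  "herald_prob p q 0 + q * herald_prob p q 1 = diag_entry"
  "herald_prob p q 2 + (1 - q) * herald_prob p q 1 = 1 - diag_entry"
  "herald_prob p q 1 * sqrt q * sqrt (1 - q) = off_diag_entry"
proof -
  have *: "1 - diag_entry = p / (p + q)"
    using p q by (simp add: diag_entry_def field_simps)
  have "herald_prob p q 0 + q * herald_prob p q 1 = (q * (1 - p) + q * p) / (p + q)"
    by (simp add: herald_prob_def add_divide_distrib)
  then show "herald_prob p q 0 + q * herald_prob p q 1 = diag_entry"
    by (simp add: diag_entry_def algebra_simps)
  have "herald_prob p q 2 + (1 - q) * herald_prob p q 1 = (p * q + (1 - q) * p) / (p + q)"
    by (simp add: herald_prob_def add_divide_distrib)
  then show "herald_prob p q 2 + (1 - q) * herald_prob p q 1 = 1 - diag_entry"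
    by (simp add: * algebra_simps)
qed (simp add: herald_prob_def off_diag_entry_def)

lemma diag_less_max_eigenvalue: "diag_entry < max_eigenvalue"
proof -
  have "sqrt ((diag_entry - 1 / 2)\<^sup>2) < sqrt ((diag_entry - 1 / 2)\<^sup>2 + off_diag_entry\<^sup>2)"
    using off_diag_pos by (intro real_sqrt_less_mono) simp
  then show ?thesis by (simp add: max_eigenvalue_def)
qed

lemma characteristic_equation:
  "(max_eigenvalue - diag_entry) * (max_eigenvalue - (1 - diag_entry)) = off_diag_entry\<^sup>2"
proof -
  have "(max_eigenvalue - 1 / 2)\<^sup>2 = (diag_entry - 1 / 2)\<^sup>2 + off_diag_entry\<^sup>2"
    by (simp add: max_eigenvalue_def)
  then show ?thesis by (simp add: power2_eq_square algebra_simps)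
qed

text \<open>The strict upper bound says that the determinant is positive, so that the second
  eigenvalue does not vanish; it reduces to \<open>p * (1 - q) < 1\<close>.\<close>

lemma max_eigenvalue_range: "1 / 2 \<le> max_eigenvalue" "max_eigenvalue < 1"
proof -
  show "1 / 2 \<le> max_eigenvalue" by (simp add: max_eigenvalue_def)
  have "p * (1 - q) < 1 * 1"
    using p q by (intro mult_strict_mono) auto
  then have "p * q * (p * (1 - q)) < p * q * 1"
    using p q by (intro mult_strict_left_mono) auto
  then have "p * q * (p * (1 - q)) / (p + q)\<^sup>2 < p * q / (p + q)\<^sup>2"
    using p q by (intro divide_strict_right_mono) auto
  moreover have "off_diag_entry\<^sup>2 = p * q * (p * (1 - q)) / (p + q)\<^sup>2"
    using q by (simp add: off_diag_entry_def power_divide power_mult_distrib) (simp add: power2_eq_square)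
  moreover have "1 - diag_entry = p / (p + q)"
    using p q by (simp add: diag_entry_def field_simps)
  then have "diag_entry * (1 - diag_entry) = p * q / (p + q)\<^sup>2"
    by (simp add: diag_entry_def power2_eq_square)
  ultimately have "off_diag_entry\<^sup>2 < diag_entry * (1 - diag_entry)"
    by (simp only:)
  moreover have "(diag_entry - 1 / 2)\<^sup>2 = (1 / 2)\<^sup>2 - diag_entry * (1 - diag_entry)"
    by (simp add: power2_eq_square algebra_simps)
  ultimately have "(diag_entry - 1 / 2)\<^sup>2 + off_diag_entry\<^sup>2 < (1 / 2)\<^sup>2"
    by linarith
  then have "sqrt ((diag_entry - 1 / 2)\<^sup>2 + off_diag_entry\<^sup>2) < sqrt ((1 / 2)\<^sup>2)"
    by (rule real_sqrt_less_mono)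
  then show "max_eigenvalue < 1" by (simp add: max_eigenvalue_def)
qed

text \<open>The weights are the overlaps of the three memory states with the leading eigenvector
  \<open>(off_diag_entry, max_eigenvalue - diag_entry)\<close> of the two-dimensional memory state.\<close>

lemma Perron_weights:
  obtains u :: "nat \<Rightarrow> real" where "\<And>i. i \<in> {0, 1, 2} \<Longrightarrow> 0 < u i"
    and "\<And>j. j \<in> {0, 1, 2} \<Longrightarrow>
      (\<Sum>i\<in>{0, 1, 2}. u i * herald_prob p q i * overlap_bound q i j) = max_eigenvalue * u j"
proof -
  define d where "d = max_eigenvalue - diag_entry"
  define a where "a = sqrt q"
  define b where "b = sqrt (1 - q)"
  define u :: "nat \<Rightarrow> real" where
    "u i = (if i = 0 then off_diag_entry else if i = 1 then a * off_diag_entry + b * d else d)" for i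
  have ab: "a * a = q" "b * b = 1 - q" "0 < a" "0 < b"
    using q by (simp_all add: a_def b_def)
  have d: "0 < d" using diag_less_max_eigenvalue by (simp add: d_def)
  have char: "d * (max_eigenvalue - (1 - diag_entry)) = off_diag_entry * off_diag_entry"
    using characteristic_equation by (simp add: d_def power2_eq_square)
  have off: "herald_prob p q 1 * a * b = off_diag_entry"
    using entries(3) by (simp add: a_def b_def)
  have eqs: "off_diag_entry * herald_prob p q 0 + (a * off_diag_entry + b * d) * herald_prob p q 1 * a
        = max_eigenvalue * off_diag_entry"
    "off_diag_entry * herald_prob p q 0 * a + (a * off_diag_entry + b * d) * herald_prob p q 1
        + d * herald_prob p q 2 * b = max_eigenvalue * (a * off_diag_entry + b * d)"
    "(a * off_diag_entry + b * d) * herald_prob p q 1 * b + d * herald_prob p q 2 = max_eigenvalue * d"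
  proof -
    \<comment> \<open>The two rows of the eigenvector equation for (\<open>off_diag_entry\<close>,
      \<open>d\<close>): the first is the definition of \<open>d\<close>, the second the
      characteristic equation.\<close>
    have row0: "off_diag_entry * diag_entry + d * off_diag_entry = max_eigenvalue * off_diag_entry"
      by (simp add: d_def algebra_simps)
    have row1: "off_diag_entry * off_diag_entry + d * (1 - diag_entry) = max_eigenvalue * d"
      using char by (simp add: algebra_simps)
    have "off_diag_entry * herald_prob p q 0 + (a * off_diag_entry + b * d) * herald_prob p q 1 * a
        = off_diag_entry * (herald_prob p q 0 + a * a * herald_prob p q 1) + d * (herald_prob p q 1 * a * b)"
      by (simp add: algebra_simps)
    then show 0: "off_diag_entry * herald_prob p q 0 + (a * off_diag_entry + b * d) * herald_prob p q 1 * a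
        = max_eigenvalue * off_diag_entry"
      by (simp only: ab entries off row0)
    have "(a * off_diag_entry + b * d) * herald_prob p q 1 * b + d * herald_prob p q 2
        = off_diag_entry * (herald_prob p q 1 * a * b) + d * (herald_prob p q 2 + b * b * herald_prob p q 1)"
      by (simp add: algebra_simps)
    then show 1: "(a * off_diag_entry + b * d) * herald_prob p q 1 * b + d * herald_prob p q 2 = max_eigenvalue * d"
      by (simp only: ab entries off row1)
    \<comment> \<open>The ket of causal state 1 is \<open>a\<close> times that of state 0 plus
      \<open>b\<close> times that of state 2, so its equation is the same combination of the other
      two.\<close>
    have "a * a + b * b = 1" by (simp add: ab)
    then have "off_diag_entry * herald_prob p q 0 * a + (a * off_diag_entry + b * d) * herald_prob p q 1
        + d * herald_prob p q 2 * b
      = a * (off_diag_entry * herald_prob p q 0 + (a * off_diag_entry + b * d) * herald_prob p q 1 * a)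
        + b * ((a * off_diag_entry + b * d) * herald_prob p q 1 * b + d * herald_prob p q 2)"
      by algebra
    then show "off_diag_entry * herald_prob p q 0 * a + (a * off_diag_entry + b * d) * herald_prob p q 1
        + d * herald_prob p q 2 * b = max_eigenvalue * (a * off_diag_entry + b * d)"
      unfolding 0 1 by (simp add: algebra_simps)
  qed
  show thesis
  proof
    fix i :: nat assume "i \<in> {0, 1, 2}"
    then show "0 < u i"
      using d off_diag_pos ab(3,4) by (auto simp: u_def intro!: add_pos_pos)
  next
    fix j :: nat assume "j \<in> {0, 1, 2}"
    then show "(\<Sum>i\<in>{0, 1, 2}. u i * herald_prob p q i * overlap_bound q i j) = max_eigenvalue * u j"
      using eqs by (auto simp: u_def overlap_bound_def a_def b_def)
  qed
qed

section \<open>Memory states of arbitrary models\<close>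

lemma past_event_prob: "measure P past_event = 1"
  using rev.prob_eq_1[OF past_event_sets] AE_past_event by simp

lemma past_event_pasts: "x \<in> past_event \<Longrightarrow> past x \<in> pasts P"
  by (simp add: past_event_def)

lemma memory_state_eq:
  "memory_state P Q a b = (LINT x|P. indicator past_event x *\<^sub>R (enc Q (past x) a * cnj (enc Q (past x) b)))"
  by (simp add: memory_state_def set_lebesgue_integral_def past_event_def)

lemma model_measurable:
  assumes "quantum_model A P Q"
  shows "(\<lambda>x. indicator past_event x *\<^sub>R (enc Q (past x) a * cnj (enc Q (past x) b))) \<in> borel_measurable P"
  using assms unfolding quantum_model_def set_borel_measurable_def past_event_def by blast

lemma model_integrable:
  assumes Q: "quantum_model A P Q"
  shows "integrable P (\<lambda>x. indicator past_event x *\<^sub>R (enc Q (past x) a * cnj (enc Q (past x) b)))"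
proof (rule rev.integrable_const_bound[where B = 1])
  have "cmod (enc Q h a * cnj (enc Q h b)) \<le> 1" if "h \<in> pasts P" for h
    using mult_mono[OF cmod_le_1[OF model_ket[OF Q that], of a] cmod_le_1[OF model_ket[OF Q that], of b]]
    by (simp add: norm_mult)
  then show "AE x in P. norm (indicator past_event x *\<^sub>R (enc Q (past x) a * cnj (enc Q (past x) b))) \<le> 1"
    by (intro AE_I2) (simp add: indicator_def past_event_pasts)
qed (rule model_measurable[OF Q])

text \<open>The memory state is an integral entry by entry, so its trace is a limit of integrals of
  partial norms, which tend to 1 on every legal past. Non-negative diagonal entries upgrade the
  ordered series to an unconditional sum.\<close>

lemma model_trace:
  assumes Q: "quantum_model A P Q"
  shows "((\<lambda>a. Re (memory_state P Q a a)) has_sum 1) UNIV"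
proof -
  define s where "s n x = (\<Sum>a<n. indicator past_event x *\<^sub>R (enc Q (past x) a * cnj (enc Q (past x) a)))" for n x
  have s: "s n x = indicator past_event x *\<^sub>R (\<Sum>a<n. cnj (enc Q (past x) a) * enc Q (past x) a)" for n x
    by (simp add: s_def scaleR_sum_right mult.commute)
  have "(\<lambda>n. LINT x|P. s n x) \<longlonglongrightarrow> (LINT x|P. indicator past_event x *\<^sub>R (1 :: complex))"
  proof (rule dominated_by_1(3)[OF rev.prob_space_axioms])
    show "s n \<in> borel_measurable P" for n
      unfolding s_def[abs_def] by (intro borel_measurable_sum model_measurable[OF Q])
    show "(\<lambda>n. s n x) \<longlonglongrightarrow> indicator past_event x *\<^sub>R 1" for x
    proof (cases "x \<in> past_event")
      case True
      note k = model_ket[OF Q past_event_pasts[OF True]]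
      show ?thesis
        using partial_inner_tendsto[OF k(1) k(1)] True by (simp add: s ket_inner_self[OF k(1)] k(2))
    qed (simp add: s)
    show "cmod (s n x) \<le> 1" for n x
    proof (cases "x \<in> past_event")
      case True
      note k = model_ket[OF Q past_event_pasts[OF True]]
      show ?thesis
        using partial_inner_bound[OF k(1) k(1), of "{..<n}"] True by (simp add: s k(2))
    qed (simp add: s)
  qed
  also have "(LINT x|P. indicator past_event x *\<^sub>R (1 :: complex)) = 1"
    using past_event_prob integral_last_symbol(2)[of "\<lambda>_. 1 :: real"]
    by (subst integral_scaleR_left) (auto simp: sets.Int_space_eq2 less_top[symmetric])
  also have "(\<lambda>n. LINT x|P. s n x) = (\<lambda>n. \<Sum>a<n. memory_state P Q a a)"
    unfolding s_def memory_state_eq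
    by (intro ext Bochner_Integration.integral_sum model_integrable[OF Q])
  finally have "(\<lambda>n. Re (\<Sum>a<n. memory_state P Q a a)) \<longlonglongrightarrow> Re 1"
    by (rule tendsto_Re)
  then have sums: "(\<lambda>a. Re (memory_state P Q a a)) sums 1"
    by (simp add: sums_def)
  have nonneg: "0 \<le> Re (memory_state P Q a a)" for a
  proof -
    have "Re (memory_state P Q a a) =
        (LINT x|P. Re (indicator past_event x *\<^sub>R (enc Q (past x) a * cnj (enc Q (past x) a))))"
      unfolding memory_state_eq by (rule integral_Re[symmetric, OF model_integrable[OF Q]])
    also have "\<dots> \<ge> 0"
      by (rule integral_nonneg_AE) (simp add: complex_mult_cnj indicator_def)
    finally show ?thesis .
  qed
  from sums_nonneg_imp_has_sum[OF sums nonneg] show ?thesis .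
qed

text \<open>Turns the matrix equation into an integral over memory states, first for each coordinate
  and then paired with a unit vector \<open>g\<close>; the series over \<open>b\<close> and over
  \<open>a\<close> are exchanged with the integral one after the other. Every integrand contains the
  encoding once as a ket and once as a bra: the phase of the encoding is arbitrary, and only such
  products are known to be measurable.\<close>

lemma model_eigenvector:
  assumes Q: "quantum_model A P Q" and v: "v \<in> ell2 UNIV" "norm_sq v = 1"
    and eig: "\<And>a. ((\<lambda>b. memory_state P Q a b * v b) has_sum complex_of_real m * v a) UNIV"
  shows "(LINT x|P. indicator past_event x *\<^sub>R (enc Q (past x) a * ket_inner (enc Q (past x)) v)) =
      complex_of_real m * v a" (is ?thesis1)
    and "g \<in> ell2 UNIV \<Longrightarrow> norm_sq g = 1 \<Longrightarrow>
      integrable P (\<lambda>x. indicator past_event x *\<^sub>R (ket_inner g (enc Q (past x)) * ket_inner (enc Q (past x)) v))"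
    and "g \<in> ell2 UNIV \<Longrightarrow> norm_sq g = 1 \<Longrightarrow>
      (LINT x|P. indicator past_event x *\<^sub>R (ket_inner g (enc Q (past x)) * ket_inner (enc Q (past x)) v)) =
      complex_of_real m * ket_inner g v"
proof -
  let ?I = "indicator past_event :: _ \<Rightarrow> real"
  let ?W = "\<lambda>x. ket_inner (enc Q (past x)) v"
  have k: "enc Q (past x) \<in> ell2 UNIV" "norm_sq (enc Q (past x)) = 1" if "x \<in> past_event" for x
    using model_ket[OF Q past_event_pasts[OF that]] by (auto intro: ell2_mono)
  have W: "cmod (?W x) \<le> 1" if "x \<in> past_event" for x
    using ket_inner_bound[OF k(1)[OF that] v(1)] by (simp add: k that v)
  have rows: "(\<lambda>x. ?I x *\<^sub>R (enc Q (past x) a * ?W x)) \<in> borel_measurable P \<and>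
      integrable P (\<lambda>x. ?I x *\<^sub>R (enc Q (past x) a * ?W x)) \<and>
      (LINT x|P. ?I x *\<^sub>R (enc Q (past x) a * ?W x)) = complex_of_real m * v a" for a
  proof -
    define s where "s n x = (\<Sum>b<n. ?I x *\<^sub>R (enc Q (past x) a * cnj (enc Q (past x) b)) * v b)" for n x
    have s: "s n x = ?I x *\<^sub>R (enc Q (past x) a * (\<Sum>b<n. cnj (enc Q (past x) b) * v b))" for n x
      by (simp add: s_def scaleR_sum_right sum_distrib_left mult.assoc)
    have 1: "s n \<in> borel_measurable P" for n
      unfolding s_def[abs_def]
      by (intro borel_measurable_sum borel_measurable_times model_measurable[OF Q] borel_measurable_const)
    have 2: "(\<lambda>n. s n x) \<longlonglongrightarrow> ?I x *\<^sub>R (enc Q (past x) a * ?W x)" for x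
    proof (cases "x \<in> past_event")
      case True
      show ?thesis unfolding s
        by (intro tendsto_scaleR tendsto_mult tendsto_const partial_inner_tendsto[OF k(1)[OF True] v(1)])
    qed (simp add: s)
    have 3: "cmod (s n x) \<le> 1" for n x
    proof (cases "x \<in> past_event")
      case True
      have "cmod (\<Sum>b<n. cnj (enc Q (past x) b) * v b) \<le> 1"
        using partial_inner_bound[OF k(1)[OF True] v(1), of "{..<n}"] by (simp add: k True v)
      with cmod_le_1[OF k[OF True], of a] show ?thesis
        using True by (simp add: s norm_mult mult_le_one)
    qed (simp add: s)
    note D = dominated_by_1[OF rev.prob_space_axioms 1 2 3]
    have "(\<lambda>n. LINT x|P. s n x) = (\<lambda>n. \<Sum>b<n. memory_state P Q a b * v b)"
    proof
      fix n
      have "(LINT x|P. s n x)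
          = (\<Sum>b<n. LINT x|P. ?I x *\<^sub>R (enc Q (past x) a * cnj (enc Q (past x) b)) * v b)"
        unfolding s_def
        by (rule Bochner_Integration.integral_sum) (intro integrable_mult_left impI model_integrable[OF Q])
      also have "\<dots> = (\<Sum>b<n. memory_state P Q a b * v b)"
        unfolding memory_state_eq by (intro sum.cong refl) (rule integral_mult_left_zero)
      finally show "(LINT x|P. s n x) = (\<Sum>b<n. memory_state P Q a b * v b)" .
    qed
    moreover have "(\<lambda>n. \<Sum>b<n. memory_state P Q a b * v b) \<longlonglongrightarrow> complex_of_real m * v a"
      using has_sum_imp_sums[OF eig] by (simp add: sums_def)
    ultimately have "(LINT x|P. ?I x *\<^sub>R (enc Q (past x) a * ?W x)) = complex_of_real m * v a"
      using LIMSEQ_unique[OF D(3)] by (simp only:)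
    with D(1,2) show ?thesis by (intro conjI)
  qed
  then show ?thesis1 by blast
  assume g: "g \<in> ell2 UNIV" "norm_sq g = 1"
  define s where "s n x = (\<Sum>a<n. cnj (g a) * (?I x *\<^sub>R (enc Q (past x) a * ?W x)))" for n x
  have s: "s n x = ?I x *\<^sub>R ((\<Sum>a<n. cnj (g a) * enc Q (past x) a) * ?W x)" for n x
    by (simp add: s_def scaleR_sum_right sum_distrib_right mult.assoc)
  have 1: "s n \<in> borel_measurable P" for n
    unfolding s_def[abs_def]
    by (intro borel_measurable_sum borel_measurable_times borel_measurable_const) (use rows in blast)
  have 2: "(\<lambda>n. s n x) \<longlonglongrightarrow> ?I x *\<^sub>R (ket_inner g (enc Q (past x)) * ?W x)" for x
  proof (cases "x \<in> past_event")
    case True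
    show ?thesis unfolding s
      by (intro tendsto_scaleR tendsto_mult tendsto_const partial_inner_tendsto[OF g(1) k(1)[OF True]])
  qed (simp add: s)
  have 3: "cmod (s n x) \<le> 1" for n x
  proof (cases "x \<in> past_event")
    case True
    have "cmod (\<Sum>a<n. cnj (g a) * enc Q (past x) a) \<le> 1"
      using partial_inner_bound[OF g(1) k(1)[OF True], of "{..<n}"] by (simp add: k True g)
    with W[OF True] show ?thesis
      using True by (simp add: s norm_mult mult_le_one)
  qed (simp add: s)
  note D = dominated_by_1[OF rev.prob_space_axioms 1 2 3]
  show "integrable P (\<lambda>x. ?I x *\<^sub>R (ket_inner g (enc Q (past x)) * ?W x))"
    by (rule D(2))
  have "(\<lambda>n. LINT x|P. s n x) = (\<lambda>n. \<Sum>a<n. cnj (g a) * (complex_of_real m * v a))"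
  proof
    fix n
    have "(LINT x|P. s n x) = (\<Sum>a<n. LINT x|P. cnj (g a) * (?I x *\<^sub>R (enc Q (past x) a * ?W x)))"
      unfolding s_def by (rule Bochner_Integration.integral_sum) (intro integrable_mult_right impI, use rows in blast)
    also have "\<dots> = (\<Sum>a<n. cnj (g a) * (complex_of_real m * v a))"
      using rows by (intro sum.cong refl) (simp only: integral_mult_right_zero)
    finally show "(LINT x|P. s n x) = (\<Sum>a<n. cnj (g a) * (complex_of_real m * v a))" .
  qed
  also have "\<dots> = (\<lambda>n. complex_of_real m * (\<Sum>a<n. cnj (g a) * v a))"
    by (simp add: sum_distrib_left mult_ac)
  finally have "(\<lambda>n. LINT x|P. s n x) \<longlonglongrightarrow> complex_of_real m * ket_inner g v"
    by (simp only:) (intro tendsto_mult tendsto_const partial_inner_tendsto[OF g(1) v(1)])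
  with D(3) show "(LINT x|P. ?I x *\<^sub>R (ket_inner g (enc Q (past x)) * ?W x)) = complex_of_real m * ket_inner g v"
    by (rule LIMSEQ_unique)
qed

text \<open>Only the suprema of the eigenvector's overlaps with the memory states of each causal state
  enter; they satisfy the same system of inequalities as a positive matrix with Perron eigenvalue
  \<open>max_eigenvalue\<close>.\<close>

lemma eigenvalue_bound:
  assumes Q: "quantum_model {0, 1, 2} P Q" and v: "v \<in> ell2 UNIV" "norm_sq v = 1" and m: "0 < m"
    and eig: "\<And>a. ((\<lambda>b. memory_state P Q a b * v b) has_sum complex_of_real m * v a) UNIV"
  shows "m \<le> max_eigenvalue"
proof -
  define S where "S j = {h \<in> pasts P. h 0 = j}" for j
  define M where "M j = (SUP h\<in>S j. cmod (ket_inner (enc Q h) v))" for j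
  have k: "enc Q h \<in> ell2 UNIV" "norm_sq (enc Q h) = 1" if "h \<in> pasts P" for h
    using model_ket[OF Q that] by (auto intro: ell2_mono)
  have bdd: "bdd_above ((\<lambda>h. cmod (ket_inner (enc Q h) v)) ` S j)" for j
  proof (rule bdd_aboveI2)
    fix h assume "h \<in> S j"
    then have h: "h \<in> pasts P" by (simp add: S_def)
    show "cmod (ket_inner (enc Q h) v) \<le> 1"
      using ket_inner_bound[OF k(1)[OF h] v(1)] by (simp add: k[OF h] v)
  qed
  have le_M: "cmod (ket_inner (enc Q h) v) \<le> M (h 0)" if "h \<in> pasts P" for h
    unfolding M_def by (rule cSUP_upper[OF _ bdd]) (use that in \<open>simp add: S_def\<close>)
  have M_nonneg: "0 \<le> M j" if "j \<in> {0, 1, 2}" for j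
  proof -
    have "\<exists>h\<in>pasts P. h 0 = j" using that by (rule past_with_symbol)
    then obtain h where "h \<in> pasts P" "h 0 = j" by (rule bexE)
    with le_M[of h] show ?thesis
      using norm_ge_zero order_trans by metis
  qed
  \<comment> \<open>Pairing the eigenvector equation with \<open>enc Q h\<close> for
    \<open>h\<close> in class \<open>i\<close> leaves two factors under the integral. One is bounded
    by the overlap bound, the other by a supremum, after which only the last symbol of the past
    matters.\<close>
  have system: "m * M i \<le> (\<Sum>j\<in>{0, 1, 2}. herald_prob p q j * (overlap_bound q i j * M j))"
    if i: "i \<in> {0, 1, 2}" for i
  proof -
    let ?R = "\<Sum>j\<in>{0, 1, 2}. herald_prob p q j * (overlap_bound q i j * M j)"
    have "\<exists>h\<in>pasts P. h 0 = i" using i by (rule past_with_symbol)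
    then have ne: "S i \<noteq> {}" by (auto simp: S_def)
    have "M i \<le> ?R / m"
      unfolding M_def[of i]
    proof (rule cSUP_least[OF ne])
      fix h assume "h \<in> S i"
      then have h: "h \<in> pasts P" "h 0 = i" by (auto simp: S_def)
      note E = model_eigenvector(2,3)[OF Q v eig k[OF h(1)]]
      have "m * cmod (ket_inner (enc Q h) v) = cmod (complex_of_real m * ket_inner (enc Q h) v)"
        using m by (simp add: norm_mult)
      also have "\<dots> \<le> (LINT x|P. cmod (indicator past_event x *\<^sub>R
          (ket_inner (enc Q h) (enc Q (past x)) * ket_inner (enc Q (past x)) v)))"
        unfolding E(2)[symmetric] by (rule integral_norm_bound)
      also have "\<dots> \<le> (LINT x|P. indicator past_event x *\<^sub>R
          (overlap_bound q i (past x 0) * M (past x 0)))"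
      proof (rule integral_mono)
        show "integrable P (\<lambda>x. cmod (indicator past_event x *\<^sub>R
            (ket_inner (enc Q h) (enc Q (past x)) * ket_inner (enc Q (past x)) v)))"
          by (rule integrable_norm[OF E(1)])
        show "integrable P (\<lambda>x. indicator past_event x *\<^sub>R (overlap_bound q i (past x 0) * M (past x 0)))"
          by (rule integral_last_symbol(1)[of "\<lambda>j. overlap_bound q i j * M j"])
        fix x
        show "cmod (indicator past_event x *\<^sub>R
            (ket_inner (enc Q h) (enc Q (past x)) * ket_inner (enc Q (past x)) v))
          \<le> indicator past_event x *\<^sub>R (overlap_bound q i (past x 0) * M (past x 0))"
        proof (cases "x \<in> past_event")
          case True
          note x = past_event_pasts[OF True]
          have "cmod (ket_inner (enc Q h) (enc Q (past x))) \<le> overlap_bound q i (past x 0)"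
            using model_overlap[OF Q h(1) x] by (simp only: h(2))
          moreover from this have "0 \<le> overlap_bound q i (past x 0)"
            using norm_ge_zero order_trans by blast
          ultimately have "cmod (ket_inner (enc Q h) (enc Q (past x))) * cmod (ket_inner (enc Q (past x)) v)
              \<le> overlap_bound q i (past x 0) * M (past x 0)"
            by (intro mult_mono le_M[OF x] norm_ge_zero)
          with True show ?thesis by (simp add: norm_mult)
        qed simp
      qed
      also have "\<dots> = ?R"
        using integral_last_symbol(2)[of "\<lambda>j. overlap_bound q i j * M j"] by simp
      finally show "cmod (ket_inner (enc Q h) v) \<le> ?R / m"
        using m by (simp add: pos_le_divide_eq mult.commute)
    qed
    then show ?thesis using m by (simp add: pos_le_divide_eq mult.commute)
  qed
  obtain u :: "nat \<Rightarrow> real" where u: "\<And>i. i \<in> {0, 1, 2} \<Longrightarrow> 0 < u i"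
    and Perron: "\<And>j. j \<in> {0, 1, 2} \<Longrightarrow>
      (\<Sum>i\<in>{0, 1, 2}. u i * herald_prob p q i * overlap_bound q i j) = max_eigenvalue * u j"
    using Perron_weights by metis
  \<comment> \<open>Left eigenvector of the coefficient matrix of \<open>system\<close>; adding the
    inequalities with these weights gives \<open>m * T \<le> max_eigenvalue * T\<close>.\<close>
  define w where "w i = u i * herald_prob p q i" for i
  have w: "0 < w i" if "i \<in> {0, 1, 2}" for i
    using u[OF that] that herald_prob_pos unfolding w_def by (intro mult_pos_pos) blast+
  define T where "T = (\<Sum>j\<in>{0, 1, 2}. w j * M j)"
  have "m * T = (\<Sum>i\<in>{0, 1, 2}. w i * (m * M i))"
    by (simp add: T_def algebra_simps)
  also have "\<dots> \<le> (\<Sum>i\<in>{0, 1, 2}. w i * (\<Sum>j\<in>{0, 1, 2}. herald_prob p q j * (overlap_bound q i j * M j)))"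
    by (intro sum_mono mult_left_mono system less_imp_le[OF w])
  also have "\<dots> = (\<Sum>i\<in>{0, 1, 2}. \<Sum>j\<in>{0, 1, 2}. w i * (herald_prob p q j * (overlap_bound q i j * M j)))"
    by (simp only: sum_distrib_left)
  also have "\<dots> = (\<Sum>j\<in>{0, 1, 2}. \<Sum>i\<in>{0, 1, 2}. w i * (herald_prob p q j * (overlap_bound q i j * M j)))"
    by (rule sum.swap)
  also have "\<dots> = (\<Sum>j\<in>{0, 1, 2}. (\<Sum>i\<in>{0, 1, 2}. w i * overlap_bound q i j) * (herald_prob p q j * M j))"
    by (simp add: algebra_simps)
  also have "\<dots> = (\<Sum>j\<in>{0, 1, 2}. max_eigenvalue * (w j * M j))"
  proof (rule sum.cong[OF refl])
    fix j :: nat assume "j \<in> {0, 1, 2}"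
    then have *: "(\<Sum>i\<in>{0, 1, 2}. w i * overlap_bound q i j) = max_eigenvalue * u j"
      unfolding w_def by (rule Perron)
    show "(\<Sum>i\<in>{0, 1, 2}. w i * overlap_bound q i j) * (herald_prob p q j * M j)
        = max_eigenvalue * (w j * M j)"
      unfolding * by (simp only: w_def mult_ac)
  qed
  also have "\<dots> = max_eigenvalue * T"
    by (simp only: T_def sum_distrib_left)
  finally have le: "m * T \<le> max_eigenvalue * T" .
  \<comment> \<open>If \<open>T\<close> vanished, \<open>v\<close> would be orthogonal to all memory
    states, the eigenvector equation would force \<open>m\<close> times \<open>v\<close> to be zero,
    and the unit vector \<open>v\<close> would be null.\<close>
  have "0 < T"
  proof (rule ccontr)
    assume "\<not> 0 < T"
    moreover have nn: "0 \<le> w j * M j" if "j \<in> {0, 1, 2}" for j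
      using M_nonneg[OF that] less_imp_le[OF w[OF that]] by (rule mult_nonneg_nonneg[rotated])
    then have "0 \<le> T" unfolding T_def by (rule sum_nonneg)
    ultimately have "T = 0" by simp
    then have "w j * M j = 0" if "j \<in> {0, 1, 2}" for j
      using nn that unfolding T_def by (subst (asm) sum_nonneg_eq_0_iff) auto
    then have M0: "M j = 0" if "j \<in> {0, 1, 2}" for j
      using w[OF that] that by (metis less_irrefl mult_eq_0_iff)
    have "ket_inner (enc Q h) v = 0" if "h \<in> pasts P" for h
    proof -
      have "h 0 \<in> {0, 1, 2}" using that by (simp add: pasts_iff)
      then have "cmod (ket_inner (enc Q h) v) \<le> 0"
        using le_M[OF that] by (simp only: M0)
      then show ?thesis by simp
    qed
    then have zero: "indicator past_event x *\<^sub>R (enc Q (past x) a * ket_inner (enc Q (past x)) v) = 0" for a x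
      by (cases "x \<in> past_event") (simp_all add: past_event_pasts)
    have "complex_of_real m * v a = 0" for a
      using model_eigenvector(1)[OF Q v eig, of a] unfolding zero by simp
    then have "v = (\<lambda>_. 0)" using m by auto
    with v show False by (simp add: norm_sq_def)
  qed
  with le show ?thesis by simp
qed

lemma model_entropy_ge:
  assumes Q: "quantum_model {0, 1, 2} P Q"
  shows "ennreal (binary_entropy max_eigenvalue) \<le> model_entropy P Q"
  unfolding model_entropy_def vn_entropy_def
proof (rule Inf_greatest, clarify)
  fix N \<mu> e assume spec: "spectral_decomposition (memory_state P Q) N \<mu> e"
  have sum: "(\<mu> has_sum 1) N"
    by (rule spectral_trace[OF spec model_trace[OF Q]])
  have e: "e k \<in> ell2 UNIV" "0 < \<mu> k" "norm_sq (e k) = 1" if "k \<in> N" for k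
    using spectral_unit[OF spec that] by auto
  have "\<mu> k \<le> max_eigenvalue" if "k \<in> N" for k
    by (rule eigenvalue_bound[OF Q e(1,3,2)[OF that] spectral_eigenvector[OF spec sum that]])
  then show "ennreal (binary_entropy max_eigenvalue) \<le> (\<Sum>\<^sub>\<infinity>k\<in>N. ennreal (- (\<mu> k * log 2 (\<mu> k))))"
    by (intro entropy_ge_binary_entropy sum e(2) max_eigenvalue_range)
qed

end

section \<open>The two-dimensional model\<close>

lemma qubit_has_sum:
  fixes \<psi> :: ket
  assumes "\<And>k. k \<notin> {0, 1} \<Longrightarrow> \<psi> k = 0"
  shows "((\<lambda>i. (cmod (\<psi> i))\<^sup>2) has_sum (cmod (\<psi> 0))\<^sup>2 + (cmod (\<psi> 1))\<^sup>2) UNIV"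
proof (rule has_sum_finite_neutralI[of "{0, 1}"])
  show "(cmod (\<psi> 0))\<^sup>2 + (cmod (\<psi> 1))\<^sup>2 = (\<Sum>i\<in>{0, 1}. (cmod (\<psi> i))\<^sup>2)" by simp
qed (use assms in auto)

lemma qubit_norm_sq:
  fixes \<psi> :: ket
  assumes "\<And>k. k \<notin> {0, 1} \<Longrightarrow> \<psi> k = 0"
  shows "norm_sq \<psi> = (cmod (\<psi> 0))\<^sup>2 + (cmod (\<psi> 1))\<^sup>2"
  unfolding norm_sq_def by (rule infsumI[OF qubit_has_sum[OF assms]])

lemma qubit_ell2:
  fixes \<psi> :: ket
  assumes "\<And>k. k \<notin> {0, 1} \<Longrightarrow> \<psi> k = 0"
  shows "\<psi> \<in> ell2 {0, 1}"
  unfolding ell2_def mem_Collect_eq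
  using assms by (intro conjI allI impI has_sum_imp_summable[OF qubit_has_sum])

lemma reverse_ket_outside: "k \<notin> {0, 1} \<Longrightarrow> reverse_ket q y k = 0"
  by (auto simp: reverse_ket_def basis_ket_def)

lemma reverse_ket_norm:
  assumes "0 \<le> q" "q \<le> 1"
  shows "(cmod (reverse_ket q y 0))\<^sup>2 + (cmod (reverse_ket q y 1))\<^sup>2 = 1"
  using assms by (simp add: reverse_ket_def basis_ket_def)

text \<open>The circuit measures the memory in the computational basis: outcome 1 occurs for memory
  \<open>|1\<rangle>\<close> and the outcomes 0 and 2 for \<open>|0\<rangle>\<close>, with the following amplitudes.\<close>

definition emission :: "real \<Rightarrow> nat \<Rightarrow> ket \<Rightarrow> complex" where
  "emission p y \<psi> =
     (if y = 0 then complex_of_real (sqrt (1 - p)) * \<psi> 0 else if y = 1 then \<psi> 1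
      else complex_of_real (sqrt p) * \<psi> 0)"

text \<open>Each outcome leaves the third qubit in a fixed state, so its Kraus operator has rank
  one. For control 0 the second qubit is rotated and, if it is 1, flips the third; for control 1 the
  third qubit is prepared as the ket of causal state 1. The ancillas start in |0>, so the gates
  enter through their first columns.\<close>

lemma reverse_kraus_eq:
  assumes "Up 0 0 = complex_of_real (sqrt (1 - p))" "Up 1 0 = complex_of_real (sqrt p)"
    and "Uq 0 0 = complex_of_real (sqrt q)" "Uq 1 0 = complex_of_real (sqrt (1 - q))"
    and "y \<in> {0, 1, 2}"
  shows "reverse_kraus Up Uq y j \<psi> = (\<lambda>k. if j = 0 then emission p y \<psi> * reverse_ket q y k else 0)"
proof -
  have two: "{..<2::nat} = {0, 1}" by auto
  have "reverse_circuit Up Uq \<psi> 0 0 = (\<lambda>k. emission p 0 \<psi> * reverse_ket q 0 k)"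
    using assms by (auto simp: reverse_circuit_def c_23_def c_13_def cbar_12_def gate_def
        basis_ket_def emission_def reverse_ket_def two)
  moreover have "reverse_circuit Up Uq \<psi> 1 0 = (\<lambda>k. emission p 1 \<psi> * reverse_ket q 1 k)"
  proof
    fix k :: nat
    consider "k = 0" | "k = 1" | "2 \<le> k" by linarith
    then show "reverse_circuit Up Uq \<psi> 1 0 k = emission p 1 \<psi> * reverse_ket q 1 k"
      using assms by cases (simp_all add: reverse_circuit_def c_23_def c_13_def cbar_12_def gate_def
        basis_ket_def emission_def reverse_ket_def two)
  qed
  moreover have "reverse_circuit Up Uq \<psi> 0 1 = (\<lambda>k. emission p 2 \<psi> * reverse_ket q 2 k)"
  proof
    fix k :: nat
    consider "k = 0" | "k = 1" | "2 \<le> k" by linarith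
    then show "reverse_circuit Up Uq \<psi> 0 1 k = emission p 2 \<psi> * reverse_ket q 2 k"
      using assms by cases (simp_all add: reverse_circuit_def c_23_def c_13_def cbar_12_def gate_def
        basis_ket_def emission_def reverse_ket_def pauli_X_def two)
  qed
  ultimately show ?thesis
    using assms(5) by (auto simp: reverse_kraus_def outcome_bits_def)
qed

text \<open>The target kets have norm one, so trace preservation concerns the emission amplitudes
  alone: the weights \<open>1 - p\<close> and \<open>p\<close> of outcomes 0 and 2 add up on |0>,
  and outcome 1 takes |1>.\<close>

lemma reverse_instrument:
  assumes p: "0 \<le> p" "p \<le> 1" and q: "0 \<le> q" "q \<le> 1"
    and K: "\<And>y j \<psi>. y \<in> {0, 1, 2} \<Longrightarrow>
      K y j \<psi> = (\<lambda>k. if j = 0 then emission p y \<psi> * reverse_ket q y k else 0)"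
  shows "instrument {0, 1, 2} {0, 1} K"
proof -
  have ell2: "K y j \<psi> \<in> ell2 {0, 1}" if "y \<in> {0, 1, 2}" for y j \<psi>
    by (rule qubit_ell2) (simp add: K[OF that] reverse_ket_outside)
  have lin: "K y j (\<lambda>i. \<phi> i + c * \<psi> i) = (\<lambda>i. K y j \<phi> i + c * K y j \<psi> i)"
    if "y \<in> {0, 1, 2}" for y j \<phi> \<psi> c
    unfolding K[OF that] by (auto simp: emission_def algebra_simps)
  have norm: "norm_sq (K y j \<psi>) = (if j = 0 then (cmod (emission p y \<psi>))\<^sup>2 else 0)"
    if y: "y \<in> {0, 1, 2}" for y j \<psi>
  proof -
    have "norm_sq (K y j \<psi>) = (cmod (K y j \<psi> 0))\<^sup>2 + (cmod (K y j \<psi> 1))\<^sup>2"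
      by (rule qubit_norm_sq) (simp add: K[OF y] reverse_ket_outside)
    also have "\<dots> = (if j = 0 then (cmod (emission p y \<psi>))\<^sup>2
        * ((cmod (reverse_ket q y 0))\<^sup>2 + (cmod (reverse_ket q y 1))\<^sup>2) else 0)"
      by (simp add: K[OF y] norm_mult power_mult_distrib distrib_left)
    finally show ?thesis by (simp only: reverse_ket_norm[OF q] mult_1_right)
  qed
  have "((\<lambda>(y, j). norm_sq (K y j \<psi>)) has_sum norm_sq \<psi>) ({0, 1, 2} \<times> UNIV)"
    if \<psi>: "\<psi> \<in> ell2 {0, 1}" for \<psi>
  proof (rule has_sum_finite_neutralI[of "{0, 1, 2} \<times> {0}"])
    have "norm_sq \<psi> = (cmod (\<psi> 0))\<^sup>2 + (cmod (\<psi> 1))\<^sup>2"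
      using \<psi> by (intro qubit_norm_sq) (simp add: ell2_def)
    also have "\<dots> = (\<Sum>y\<in>{0, 1, 2}. (cmod (emission p y \<psi>))\<^sup>2)"
      using p by (simp add: emission_def norm_mult power_mult_distrib algebra_simps)
    also have "\<dots> = (\<Sum>y\<in>{0, 1, 2}. \<Sum>j\<in>{0}. norm_sq (K y j \<psi>))"
      by (simp add: norm)
    also have "\<dots> = (\<Sum>(y, j)\<in>{0, 1, 2} \<times> {0}. norm_sq (K y j \<psi>))"
      by (rule sum.cartesian_product)
    finally show "norm_sq \<psi> = (\<Sum>(y, j)\<in>{0, 1, 2} \<times> {0}. norm_sq (K y j \<psi>))" .
  next
    fix x :: "nat \<times> nat" assume "x \<in> {0, 1, 2} \<times> UNIV - {0, 1, 2} \<times> {0}"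
    then obtain y j where x: "x = (y, j)" "y \<in> {0, 1, 2}" "j \<noteq> 0" by blast
    then show "(case x of (y, j) \<Rightarrow> norm_sq (K y j \<psi>)) = 0" by (simp add: norm[OF x(2)])
  qed auto
  note sum = this
  show ?thesis
    unfolding instrument_def by (intro conjI ballI allI ell2 lin sum)
qed

section \<open>Validity and entropy of the proposed model\<close>

context heralding_coin
begin

lemma emission_prob:
  assumes h: "h \<in> pasts P" and y: "y \<in> {0, 1, 2}"
  shows "(cmod (emission p y (reverse_ket q (h 0))))\<^sup>2 = cond_future P h [y]"
proof -
  have "h 0 \<in> {0, 1, 2}" using h by (simp add: pasts_iff)
  then have "h 0 = 0 \<or> h 0 = 1 \<or> h 0 = 2" by simp
  moreover have "y = 0 \<or> y = 1 \<or> y = 2" using y by simp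
  ultimately show ?thesis
    using p q
    by (elim disjE) (simp_all only: cond_future_table[OF h],
      simp_all add: emission_def reverse_ket_def basis_ket_def norm_mult power_mult_distrib)
qed

lemma reverse_model:
  assumes \<epsilon>: "\<And>h. h \<in> pasts P \<Longrightarrow> \<epsilon> h = reverse_ket q (h 0)"
    and K: "\<And>y j \<psi>. y \<in> {0, 1, 2} \<Longrightarrow>
      K y j \<psi> = (\<lambda>k. if j = 0 then emission p y \<psi> * reverse_ket q y k else 0)"
  shows "quantum_model {0, 1, 2} P
    \<lparr> qbasis = {0, 1}, enc = \<epsilon>, qstates = reverse_ket q ` {0, 1, 2}, kraus = K \<rparr>"
proof -
  have unit: "norm_sq (\<lambda>k. c * reverse_ket q y k) = (cmod c)\<^sup>2" for c y
  proof -
    have "norm_sq (\<lambda>k. c * reverse_ket q y k)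
        = (cmod (c * reverse_ket q y 0))\<^sup>2 + (cmod (c * reverse_ket q y 1))\<^sup>2"
      by (rule qubit_norm_sq) (simp add: reverse_ket_outside)
    also have "\<dots> = (cmod c)\<^sup>2 * ((cmod (reverse_ket q y 0))\<^sup>2 + (cmod (reverse_ket q y 1))\<^sup>2)"
      by (simp add: norm_mult power_mult_distrib distrib_left)
    finally show ?thesis using reverse_ket_norm[of q y] q by simp
  qed
  have states: "reverse_ket q ` {0, 1, 2} \<subseteq> {\<psi> \<in> ell2 {0, 1}. norm_sq \<psi> = 1}"
  proof (rule image_subsetI)
    fix y
    show "reverse_ket q y \<in> {\<psi> \<in> ell2 {0, 1}. norm_sq \<psi> = 1}"
      using qubit_ell2[OF reverse_ket_outside] unit[of 1 y] by simp
  qed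
  have enc: "\<forall>h\<in>pasts P. \<epsilon> h \<in> reverse_ket q ` {0, 1, 2}"
    using \<epsilon> by (auto simp: pasts_iff)
  have meas: "set_borel_measurable P {x \<in> space P. past x \<in> pasts P}
      (\<lambda>x. \<epsilon> (past x) a * cnj (\<epsilon> (past x) b))" for a b
  proof -
    have "(\<lambda>x. indicator past_event x *\<^sub>R (\<epsilon> (past x) a * cnj (\<epsilon> (past x) b))) =
      (\<lambda>x. indicator past_event x *\<^sub>R (reverse_ket q (past x 0) a * cnj (reverse_ket q (past x 0) b)))"
    proof
      fix x
      show "indicator past_event x *\<^sub>R (\<epsilon> (past x) a * cnj (\<epsilon> (past x) b)) =
        indicator past_event x *\<^sub>R (reverse_ket q (past x 0) a * cnj (reverse_ket q (past x 0) b))"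
        by (cases "x \<in> past_event") (simp_all add: past_event_pasts \<epsilon>)
    qed
    then show ?thesis
      unfolding set_borel_measurable_def past_event_def[symmetric]
      using borel_measurable_integrable[OF integral_last_symbol(1)[of "\<lambda>j. reverse_ket q j a * cnj (reverse_ket q j b)"]]
      by simp
  qed
  have outcome: "((\<lambda>j. norm_sq (K y j (\<epsilon> h))) has_sum cond_future P h [y]) UNIV"
    if h: "h \<in> pasts P" and y: "y \<in> {0, 1, 2}" for h y
  proof (rule has_sum_finite_neutralI[of "{0}"])
    show "cond_future P h [y] = (\<Sum>j\<in>{0}. norm_sq (K y j (\<epsilon> h)))"
      using emission_prob[OF h y] by (simp add: K[OF y] unit \<epsilon>[OF h])
  qed (auto simp: K[OF y] norm_sq_def)
  have update: "((\<lambda>j. K y j (\<epsilon> h) a * cnj (K y j (\<epsilon> h) b)) has_sum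
      complex_of_real (cond_future P h [y]) * (\<epsilon> (case_nat y h) a * cnj (\<epsilon> (case_nat y h) b))) UNIV"
    if h: "h \<in> pasts P" and y: "y \<in> {0, 1, 2}" and pos: "0 < cond_future P h [y]" for h y a b
  proof (rule has_sum_finite_neutralI[of "{0}"])
    \<comment> \<open>\<open>\<epsilon>\<close> is prescribed on \<open>pasts P\<close> only; the
      positive emission probability puts the extended past there.\<close>
    have "\<epsilon> (case_nat y h) = reverse_ket q y"
      using \<epsilon>[OF extended_past[OF h pos]] by simp
    then show "complex_of_real (cond_future P h [y]) * (\<epsilon> (case_nat y h) a * cnj (\<epsilon> (case_nat y h) b))
        = (\<Sum>j\<in>{0}. K y j (\<epsilon> h) a * cnj (K y j (\<epsilon> h) b))"
      unfolding emission_prob[OF h y, symmetric] complex_norm_square by (simp add: K[OF y] \<epsilon>[OF h])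
  qed (auto simp: K[OF y])
  have "instrument {0, 1, 2} {0, 1} K"
    by (rule reverse_instrument[of p q]) (use p q K in auto)
  with states enc meas outcome update show ?thesis
    unfolding quantum_model_def by simp
qed

lemma reverse_memory_state:
  assumes Q: "\<And>h. h \<in> pasts P \<Longrightarrow> enc Q h = reverse_ket q (h 0)"
  shows "memory_state P Q a b = complex_of_real
    (if a = 0 \<and> b = 0 then diag_entry else if a = 1 \<and> b = 1 then 1 - diag_entry
     else if a + b = 1 then off_diag_entry else 0)"
proof -
  have sq: "sqrt q * sqrt q = q" "sqrt (1 - q) * sqrt (1 - q) = 1 - q"
    using q by simp_all
  have "memory_state P Q a b = (LINT x|P. indicator past_event x *\<^sub>R
      (reverse_ket q (past x 0) a * cnj (reverse_ket q (past x 0) b)))"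
    unfolding memory_state_eq
  proof (rule Bochner_Integration.integral_cong[OF refl])
    fix x
    show "indicator past_event x *\<^sub>R (enc Q (past x) a * cnj (enc Q (past x) b)) =
      indicator past_event x *\<^sub>R (reverse_ket q (past x 0) a * cnj (reverse_ket q (past x 0) b))"
      by (cases "x \<in> past_event") (simp_all add: past_event_pasts Q)
  qed
  also have "\<dots> = (\<Sum>j\<in>{0, 1, 2}. herald_prob p q j *\<^sub>R (reverse_ket q j a * cnj (reverse_ket q j b)))"
    by (rule integral_last_symbol(2))
  also have "\<dots> = complex_of_real (
      (if a = 0 \<and> b = 0 then herald_prob p q 0 + (sqrt q * sqrt q) * herald_prob p q 1
       else if a = 1 \<and> b = 1 then herald_prob p q 2 + (sqrt (1 - q) * sqrt (1 - q)) * herald_prob p q 1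
       else if a + b = 1 then herald_prob p q 1 * sqrt q * sqrt (1 - q) else 0))"
  proof -
    consider "a = 0" "b = 0" | "a = 0" "b = 1" | "a = 1" "b = 0" | "a = 1" "b = 1" | "2 \<le> a" | "2 \<le> b"
      by linarith
    then show ?thesis
      by cases (simp_all add: reverse_ket_def basis_ket_def scaleR_conv_of_real del: real_sqrt_mult_self)
  qed
  finally show ?thesis unfolding sq entries .
qed

text \<open>An explicit diagonalisation bounds the infimum from above: the leading eigenvector is
  (\<open>off_diag_entry\<close>, \<open>max_eigenvalue - diag_entry\<close>) normalised to
  (\<open>b\<close>, \<open>c\<close>), the second is the orthogonal vector (\<open>c\<close>,
  \<open>- b\<close>), and trace one gives its eigenvalue.\<close>

lemma reverse_model_entropy:
  assumes Q: "\<And>h. h \<in> pasts P \<Longrightarrow> enc Q h = reverse_ket q (h 0)"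
  shows "model_entropy P Q \<le> ennreal (binary_entropy max_eigenvalue)"
proof -
  define d where "d = max_eigenvalue - diag_entry"
  define B where "B = off_diag_entry"
  define n where "n = sqrt (B\<^sup>2 + d\<^sup>2)"
  define \<mu> where "\<mu> k = (if k = 0 then max_eigenvalue else 1 - max_eigenvalue)" for k :: nat
  define b where "b = B / n"
  define c where "c = d / n"
  define r :: "nat \<Rightarrow> nat \<Rightarrow> real" where
    "r k i = (if k = 0 then (if i = 0 then b else if i = 1 then c else 0)
       else (if i = 0 then c else if i = 1 then - b else 0))" for k i
  define e :: "nat \<Rightarrow> ket" where "e k i = complex_of_real (r k i)" for k i
  have pos: "0 < B" "0 < d"
    using off_diag_pos diag_less_max_eigenvalue by (simp_all add: B_def d_def)
  have n: "n * n = B * B + d * d" "n \<noteq> 0"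
  proof -
    show "n \<noteq> 0" using pos by (simp add: n_def)
    show "n * n = B * B + d * d" by (simp add: n_def power2_eq_square)
  qed
  have char: "d * (max_eigenvalue + diag_entry - 1) = B * B"
    using characteristic_equation by (simp add: d_def B_def power2_eq_square algebra_simps)
  have e_out: "e k i = 0" if "i \<notin> {0, 1}" for k i
    using that by (simp add: e_def r_def)
  have inner: "ket_inner (e k) (e l) = complex_of_real (r k 0 * r l 0 + r k 1 * r l 1)" for k l
    unfolding ket_inner_def
  proof (rule infsumI, rule has_sum_finite_neutralI[of "{0, 1}"])
    show "complex_of_real (r k 0 * r l 0 + r k 1 * r l 1) = (\<Sum>i\<in>{0, 1}. cnj (e k i) * e l i)"
      by (simp add: e_def)
  qed (use e_out in auto)
  have bc: "B = b * n" "d = c * n" using n(2) by (simp_all add: b_def c_def)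
  \<comment> \<open>Clears denominators, so that the square root \<open>n\<close> occurs only
    squared and the identities become polynomial.\<close>
  have cancel: "x = y" if "x * (n * n) = y * (n * n)" for x y
    using that n(2) by simp
  have nn: "b * b + c * c = 1"
    using n(1) bc by - (rule cancel, algebra)
  have m00: "max_eigenvalue * (b * b) + (1 - max_eigenvalue) * (c * c) = diag_entry"
    and m11: "max_eigenvalue * (c * c) + (1 - max_eigenvalue) * (b * b) = 1 - diag_entry"
    and m01: "max_eigenvalue * (b * c) - (1 - max_eigenvalue) * (c * b) = B"
  proof -
    \<comment> \<open>All three entry identities follow from the characteristic equation, used to
      eliminate \<open>B * B\<close>.\<close>
    have "max_eigenvalue * (B * B) + (1 - max_eigenvalue) * (d * d) = diag_entry * (n * n)"
      unfolding n(1) char[symmetric] by (simp add: d_def algebra_simps)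
    then show "max_eigenvalue * (b * b) + (1 - max_eigenvalue) * (c * c) = diag_entry"
      using bc by - (rule cancel, algebra)
    have "max_eigenvalue * (d * d) + (1 - max_eigenvalue) * (B * B) = (1 - diag_entry) * (n * n)"
      unfolding n(1) char[symmetric] by (simp add: d_def algebra_simps)
    then show "max_eigenvalue * (c * c) + (1 - max_eigenvalue) * (b * b) = 1 - diag_entry"
      using bc by - (rule cancel, algebra)
    have "max_eigenvalue * (B * d) - (1 - max_eigenvalue) * (d * B) = B * (n * n)"
      unfolding n(1) char[symmetric] by (simp add: d_def algebra_simps)
    then show "max_eigenvalue * (b * c) - (1 - max_eigenvalue) * (c * b) = B"
      using bc by - (rule cancel, algebra)
  qed
  have m10: "max_eigenvalue * (c * b) - (1 - max_eigenvalue) * (b * c) = B"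
    using m01 by (simp add: mult.commute)
  have "spectral_decomposition (memory_state P Q) {0, 1} \<mu> e"
    unfolding spectral_decomposition_def
  proof (intro conjI ballI allI)
    fix k :: nat
    show "0 < \<mu> k" using max_eigenvalue_range by (simp add: \<mu>_def)
    show "e k \<in> ell2 UNIV" by (rule ell2_mono[OF qubit_ell2]) (rule e_out)
  next
    fix k l :: nat assume "k \<in> {0, 1}" "l \<in> {0, 1}"
    then show "ket_inner (e k) (e l) = (if k = l then 1 else 0)"
      using nn unfolding inner by (auto simp: r_def add.commute simp del: of_real_add of_real_mult)
  next
    fix i j
    have "(\<Sum>k\<in>{0, 1}. complex_of_real (\<mu> k) * (e k i * cnj (e k j))) = memory_state P Q i j"
    proof -
      have "(\<Sum>k\<in>{0, 1}. complex_of_real (\<mu> k) * (e k i * cnj (e k j))) =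
          complex_of_real (max_eigenvalue * (r 0 i * r 0 j) + (1 - max_eigenvalue) * (r 1 i * r 1 j))"
        by (simp add: \<mu>_def e_def)
      also have "max_eigenvalue * (r 0 i * r 0 j) + (1 - max_eigenvalue) * (r 1 i * r 1 j) =
          (if i = 0 \<and> j = 0 then diag_entry else if i = 1 \<and> j = 1 then 1 - diag_entry
           else if i + j = 1 then off_diag_entry else 0)"
      proof -
        consider "i = 0" "j = 0" | "i = 0" "j = 1" | "i = 1" "j = 0" | "i = 1" "j = 1" | "2 \<le> i" | "2 \<le> j"
          by linarith
        then show ?thesis
          using m00 m01 m11 m10 by cases (simp_all add: r_def B_def)
      qed
      finally show ?thesis by (simp only: reverse_memory_state[OF Q])
    qed
    then show "((\<lambda>k. complex_of_real (\<mu> k) * (e k i * cnj (e k j))) has_sum memory_state P Q i j) {0, 1}"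
      by (intro has_sum_finiteI) auto
  qed
  then have "model_entropy P Q \<le> (\<Sum>\<^sub>\<infinity>k\<in>{0, 1}. ennreal (- (\<mu> k * log 2 (\<mu> k))))"
    unfolding model_entropy_def vn_entropy_def by (intro Inf_lower) blast
  also have "\<dots> = ennreal (- (max_eigenvalue * log 2 max_eigenvalue))
      + ennreal (- ((1 - max_eigenvalue) * log 2 (1 - max_eigenvalue)))"
    by (simp add: \<mu>_def)
  also have "\<dots> = ennreal (binary_entropy max_eigenvalue)"
    using max_eigenvalue_range
    by (subst ennreal_plus[symmetric]) (auto simp: binary_entropy_def mult_nonneg_nonpos)
  finally show ?thesis .
qed

end

theorem theorem2:
  fixes p q :: real
    and C P :: "(int \<Rightarrow> nat) measure"
    and Up Uq :: "nat \<Rightarrow> nat \<Rightarrow> complex"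
    and s :: "nat \<Rightarrow> (nat \<Rightarrow> nat) set"
    and \<epsilon> :: "(nat \<Rightarrow> nat) \<Rightarrow> ket"
  assumes "0 < p" "p < 1" "0 < q" "q < 1"
    and "stationary_coin p q C"
    and "P = time_reversal (heralding C)"
    and "\<And>j. s j = {h \<in> pasts P. h 0 = j}"
    and "\<And>h i. h \<in> pasts P \<Longrightarrow> i \<in> {0, 1, 2} \<Longrightarrow> \<epsilon> h = reverse_ket q i \<longleftrightarrow> h \<in> s i"
    and "qubit_unitary Up"
    and "Up 0 0 = complex_of_real (sqrt (1 - p))" "Up 1 0 = complex_of_real (sqrt p)"
    and "qubit_unitary Uq"
    and "Uq 0 0 = complex_of_real (sqrt q)" "Uq 1 0 = complex_of_real (sqrt (1 - q))"
  shows "causal_states P = {s 0, s 1, s 2} \<and>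
         optimal_quantum_model {0, 1, 2} P
           \<lparr> qbasis = {0, 1}, enc = \<epsilon>, qstates = reverse_ket q ` {0, 1, 2},
             kraus = reverse_kraus Up Uq \<rparr>"
proof -
  interpret heralding_coin p q C P
    by unfold_locales (use assms(1-6) in auto)
  have \<epsilon>: "\<epsilon> h = reverse_ket q (h 0)" if "h \<in> pasts P" for h
  proof -
    have "h 0 \<in> {0, 1, 2}" using that by (simp add: pasts_iff)
    moreover have "h \<in> s (h 0)" using that by (simp add: assms(7))
    ultimately show ?thesis using assms(8)[OF that] by blast
  qed
  have K: "reverse_kraus Up Uq y j \<psi> = (\<lambda>k. if j = 0 then emission p y \<psi> * reverse_ket q y k else 0)"
    if "y \<in> {0, 1, 2}" for y j \<psi>
    by (rule reverse_kraus_eq) (rule assms(10,11,13,14) that)+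
  have "causal_states P = {s 0, s 1, s 2}"
    by (simp only: causal_states_eq assms(7))
  moreover have "optimal_quantum_model {0, 1, 2} P
      \<lparr> qbasis = {0, 1}, enc = \<epsilon>, qstates = reverse_ket q ` {0, 1, 2}, kraus = reverse_kraus Up Uq \<rparr>"
    unfolding optimal_quantum_model_def
  proof (intro conjI allI impI)
    fix Q' assume "quantum_model {0, 1, 2} P Q'"
    then show "model_entropy P \<lparr> qbasis = {0, 1}, enc = \<epsilon>, qstates = reverse_ket q ` {0, 1, 2},
        kraus = reverse_kraus Up Uq \<rparr> \<le> model_entropy P Q'"
      by (rule order_trans[OF reverse_model_entropy model_entropy_ge, rotated]) (simp add: \<epsilon>)
  qed (rule reverse_model, erule \<epsilon>, erule K)
  ultimately show ?thesis ..
qed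

end
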